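(* For every integer $n\ge 2$, $\theta(K_n\times K_2)=\lceil n/4\rceil$.
   Context: The thickness $\theta(G)$ of a graph $G$ is the minimum number of planar subgraphs whose union is $G$. The Kronecker product $G\times H$ of graphs $G$ and $H$ is the graph with vertex set $V(G)\times V(H)$ in which $(g,h)$ and $(g',h')$ are adjacent if and only if $gg'\in E(G)$ and $hh'\in E(H)$. $K_n$ denotes the complete graph on $n$ vertices. *)

theory Defs
  imports "HOL-Analysis.Analysis"
begin

definition simple_graph :: "'a set \<Rightarrow> 'a set set \<Rightarrow> bool" where
  "simple_graph V E \<longleftrightarrow> finite V \<and> (\<forall>e\<in>E. e \<subseteq> V \<and> card e = 2)"

definition planar :: "'a set \<Rightarrow> 'a set set \<Rightarrow> bool" where
  "planar V E \<longleftrightarrow>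
     (\<exists>(pos :: 'a \<Rightarrow> complex) (arcs :: 'a set \<Rightarrow> real \<Rightarrow> complex).
        inj_on pos V \<and>
        (\<forall>e\<in>E. arc (arcs e) \<and>
                {pathstart (arcs e), pathfinish (arcs e)} = pos ` e \<and>
                path_image (arcs e) \<inter> pos ` V = pos ` e) \<and>
        (\<forall>e\<in>E. \<forall>e'\<in>E. e \<noteq> e' \<longrightarrow>
                path_image (arcs e) \<inter> path_image (arcs e') \<subseteq> pos ` (e \<inter> e')))"

definition thickness :: "'a set \<Rightarrow> 'a set set \<Rightarrow> nat" where
  "thickness V E = (LEAST k. \<exists>F :: nat \<Rightarrow> 'a set set.
       (\<forall>i<k. F i \<subseteq> E \<and> planar V (F i)) \<and> (\<Union>i<k. F i) = E)"

definition complete_edges :: "'a set \<Rightarrow> 'a set set" where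
  "complete_edges V = {{u, v} | u v. u \<in> V \<and> v \<in> V \<and> u \<noteq> v}"

definition kron_edges :: "'a set set \<Rightarrow> 'b set set \<Rightarrow> ('a \<times> 'b) set set" where
  "kron_edges EG EH = {{(g, h), (g', h')} | g h g' h'. {g, g'} \<in> EG \<and> {h, h'} \<in> EH}"

end

theory Submission
  imports Defs
begin

text \<open>
  Lower bound. A planar graph of girth at least \<open>g\<close> on \<open>N \<ge> g / 2 + 1\<close> vertices has at most
  \<open>g (N - 2) / (g - 2)\<close> edges, hence a bipartite one at most \<open>2 N - 4\<close>, while \<open>K\<^sub>n \<times> K\<^sub>2\<close> is
  bipartite with \<open>2 n\<close> vertices and \<open>n (n - 1)\<close> edges. The edge bound is proved without Euler's
  formula: if \<open>e\<close> edges and \<open>i\<close> vertices lie inside a cycle of length \<open>c\<close>, then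
  \<open>(g - 2) e \<le> g i + c - g\<close>. If a path through the interior joins two vertices of the cycle, the
  theta curve theorem splits the interior and the two bounds add up; otherwise every component of
  the interior graph is attached to at most one vertex of the cycle and has few edges by induction
  on the number of vertices. An inversion of the plane exchanges the inside and the outside of a
  cycle.

  Upper bound. Layer \<open>r\<close> consists of the cube \<open>K\<^sub>4 \<times> K\<^sub>2\<close> on the eight vertices \<open>(x, s)\<close> with
  \<open>x div 4 = r\<close>, drawn with four of its faces between two concentric squares, and of the remaining
  vertices, each placed in one of these four faces and joined to two opposite corners of it.
\<close>

section \<open>Paths and cycles as vertex lists\<close>

fun path_edges :: "'a list \<Rightarrow> 'a set set" where
  "path_edges (x # y # zs) = insert {x, y} (path_edges (y # zs))"
| "path_edges _ = {}"

definition cycle_edges :: "'a list \<Rightarrow> 'a set set" where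
  "cycle_edges xs = path_edges (xs @ [hd xs])"

definition cycle_in :: "'a set set \<Rightarrow> 'a list \<Rightarrow> bool" where
  "cycle_in E xs \<longleftrightarrow> distinct xs \<and> 3 \<le> length xs \<and> cycle_edges xs \<subseteq> E"

lemma path_edges_Cons:
  "xs \<noteq> [] \<Longrightarrow> path_edges (x # xs) = insert {x, hd xs} (path_edges xs)"
  by (cases xs) auto

lemma path_edges_append:
  "path_edges (xs @ y # ys) = path_edges (xs @ [y]) \<union> path_edges (y # ys)"
proof (induction xs)
  case (Cons x xs)
  then show ?case by (simp add: path_edges_Cons hd_append)
qed simp

lemma path_edges_snoc:
  assumes "xs \<noteq> []"
  shows "path_edges (xs @ [y]) = insert {last xs, y} (path_edges xs)"
  using assms by (induction xs rule: path_edges.induct) (auto simp: insert_commute)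

lemma path_edges_rev: "path_edges (rev xs) = path_edges xs"
proof (induction xs rule: path_edges.induct)
  case (1 x y zs)
  then show ?case
    by (simp add: path_edges_append[of "rev zs" y "[x]"] insert_commute)
qed auto

lemma finite_path_edges: "finite (path_edges xs)"
  by (induction xs rule: path_edges.induct) auto

lemma card_path_edges: "card (path_edges xs) \<le> length xs - 1"
proof (induction xs rule: path_edges.induct)
  case (1 x y zs)
  then show ?case
    using card_insert_le_m1[of "Suc (length zs)" "path_edges (y # zs)" "{x, y}"] by simp
qed auto

lemma path_edges_subset: "e \<in> path_edges xs \<Longrightarrow> e \<subseteq> set xs"
  by (induction xs rule: path_edges.induct) auto

lemma card_path_edge: "distinct xs \<Longrightarrow> e \<in> path_edges xs \<Longrightarrow> card e = 2"
  by (induction xs rule: path_edges.induct) auto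

lemma Union_path_edges: "length xs \<ge> 2 \<Longrightarrow> \<Union> (path_edges xs) = set xs"
proof (induction xs rule: path_edges.induct)
  case (1 x y zs)
  then show ?case by (cases zs) auto
qed auto

lemma path_ends_not_edge:
  assumes "distinct (a # xs @ [b])" "xs \<noteq> []"
  shows "{a, b} \<notin> path_edges (a # xs @ [b])"
proof -
  have "path_edges (a # xs @ [b]) = insert {a, hd xs} (path_edges (xs @ [b]))"
    using assms by (simp add: path_edges_Cons)
  moreover have "{a, b} \<notin> path_edges (xs @ [b])"
    using path_edges_subset[of "{a, b}" "xs @ [b]"] assms by auto
  moreover have "b \<noteq> hd xs" "a \<noteq> b" using assms by (cases xs; auto)+
  ultimately show ?thesis by (auto simp: doubleton_eq_iff)
qed

lemma card_cycle_edges: "card (cycle_edges xs) \<le> length xs"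
  unfolding cycle_edges_def using card_path_edges[of "xs @ [hd xs]"] by simp

lemma Union_cycle_edges: "xs \<noteq> [] \<Longrightarrow> \<Union> (cycle_edges xs) = set xs"
  unfolding cycle_edges_def by (subst Union_path_edges) (auto simp: Suc_le_eq)

lemma cycle_edges_split:
  "cycle_edges (a # xs @ b # ys) = path_edges (a # xs @ [b]) \<union> path_edges (b # ys @ [a])"
  using path_edges_append[of "a # xs" b "ys @ [a]"] by (simp add: cycle_edges_def)

lemma cycle_edges_rotate: "cycle_edges (us @ a # ws) = cycle_edges (a # ws @ us)"
proof (cases us)
  case (Cons u us')
  then show ?thesis
    using cycle_edges_split[of u us' a ws] cycle_edges_split[of a ws u us'] by auto
qed simp

lemma cycle_edges_rotate_to:
  assumes "distinct vs" "a \<in> set vs" "b \<in> set vs" "a \<noteq> b"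
  obtains xs ys where "cycle_edges (a # xs @ b # ys) = cycle_edges vs"
    "distinct (a # xs @ b # ys)" "length (a # xs @ b # ys) = length vs"
    "set (a # xs @ b # ys) = set vs"
proof -
  obtain us ws where vs: "vs = us @ a # ws" using split_list[OF assms(2)] by blast
  then have "b \<in> set (ws @ us)" using assms by auto
  then obtain xs ys where xs: "ws @ us = xs @ b # ys" using split_list by metis
  then have rot: "a # xs @ b # ys = a # ws @ us" by simp
  show thesis
    by (rule that[of xs ys], unfold rot) (use assms(1) vs cycle_edges_rotate[of us a ws] in auto)
qed

lemma cycle_paths_edge_disjoint:
  assumes "distinct (a # xs @ b # ys)" "xs \<noteq> [] \<or> ys \<noteq> []"
  shows "path_edges (a # xs @ [b]) \<inter> path_edges (b # ys @ [a]) = {}"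
proof (rule ccontr)
  assume "path_edges (a # xs @ [b]) \<inter> path_edges (b # ys @ [a]) \<noteq> {}"
  then obtain e where e: "e \<in> path_edges (a # xs @ [b])" "e \<in> path_edges (b # ys @ [a])" by blast
  then have "e \<subseteq> {a, b}"
    using path_edges_subset[OF e(1)] path_edges_subset[OF e(2)] assms(1) by auto
  moreover have "card e = card {a, b}"
    using card_path_edge[OF _ e(1)] assms(1) by simp
  ultimately have "e = {a, b}" by (metis card_subset_eq finite.emptyI finite_insert)
  then show False
    using e path_ends_not_edge[of a xs b] path_ends_not_edge[of b ys a] assms
    by (auto simp: insert_commute)
qed

section \<open>Acyclic graphs and girth\<close>

definition induced :: "'a set set \<Rightarrow> 'a set \<Rightarrow> 'a set set" where
  "induced E X = {e \<in> E. e \<subseteq> X}"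

definition degree :: "'a set set \<Rightarrow> 'a \<Rightarrow> nat" where
  "degree E v = card {e \<in> E. v \<in> e}"

definition girth_at_least :: "nat \<Rightarrow> 'a set set \<Rightarrow> bool" where
  "girth_at_least g E \<longleftrightarrow> (\<forall>vs. cycle_in E vs \<longrightarrow> g \<le> length vs)"

lemma girth_at_least_subset: "girth_at_least g E \<Longrightarrow> F \<subseteq> E \<Longrightarrow> girth_at_least g F"
  unfolding girth_at_least_def cycle_in_def by blast

lemma simple_graph_finite_edges:
  assumes "simple_graph V E"
  shows "finite E"
  using assms finite_subset[of E "Pow V"] by (auto simp: simple_graph_def)

lemma simple_graph_induced:
  "simple_graph V E \<Longrightarrow> X \<subseteq> V \<Longrightarrow> simple_graph X (induced E X)"
  by (auto simp: simple_graph_def induced_def intro: finite_subset)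

lemma obtain_path_without_extension:
  assumes graph: "simple_graph V E" and "V \<noteq> {}"
  obtains x xs where "x \<in> V" "distinct (x # xs)" "path_edges (x # xs) \<subseteq> E"
    "{w. {x, w} \<in> E} \<subseteq> set xs"
proof -
  let ?P = "\<lambda>xs. distinct xs \<and> xs \<noteq> [] \<and> set xs \<subseteq> V \<and> path_edges xs \<subseteq> E"
  obtain v where "v \<in> V" using \<open>V \<noteq> {}\<close> by blast
  then have "?P [v]" by simp
  moreover have "\<forall>xs. ?P xs \<longrightarrow> length xs < Suc (card V)"
    using graph by (metis card_mono distinct_card less_Suc_eq_le simple_graph_def)
  ultimately obtain p where p: "?P p" and longest: "\<And>xs. ?P xs \<Longrightarrow> length xs \<le> length p"
    using ex_has_greatest_nat[of ?P "[v]" length "Suc (card V)"] by blast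
  obtain x xs where p_eq: "p = x # xs" using p by (cases p) auto
  have "w \<in> set xs" if e: "{x, w} \<in> E" for w
  proof (rule ccontr)
    assume "w \<notin> set xs"
    moreover have "w \<noteq> x" "w \<in> V" using graph e by (auto simp: simple_graph_def)
    ultimately have "?P (w # p)" using p e by (auto simp: p_eq insert_commute)
    then have "length (w # p) \<le> length p" by (rule longest)
    then show False by simp
  qed
  then show thesis using that[of x xs] p unfolding p_eq by auto
qed

lemma cycle_in_of_path_and_chord:
  assumes "distinct (x # us @ w # ws)" "path_edges (x # us @ w # ws) \<subseteq> E"
    and "us \<noteq> []" "{x, w} \<in> E"
  shows "cycle_in E (x # us @ [w])"
proof -
  have "cycle_edges (x # us @ [w]) = path_edges (x # us @ [w]) \<union> {{x, w}}"
    using cycle_edges_split[of x us w "[]"] by (simp add: insert_commute)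
  also have "\<dots> \<subseteq> E"
    using path_edges_append[of "x # us" w ws] assms(2,4) by simp
  finally show ?thesis using assms(1,3) by (simp add: cycle_in_def Suc_le_eq)
qed

lemma obtain_second_neighbour:
  assumes "simple_graph V E" "2 \<le> degree E x"
  obtains w where "{x, w} \<in> E" "w \<noteq> y"
proof -
  have "\<not> {e \<in> E. x \<in> e} \<subseteq> {{x, y}}"
  proof
    assume "{e \<in> E. x \<in> e} \<subseteq> {{x, y}}"
    then have "degree E x \<le> card {{x, y}}" unfolding degree_def by (intro card_mono) auto
    then show False using assms(2) by simp
  qed
  then obtain e where e: "e \<in> E" "x \<in> e" "e \<noteq> {x, y}" by blast
  moreover have "card e = 2" using assms(1) e(1) by (auto simp: simple_graph_def)
  ultimately obtain w where "e = {x, w}" by (auto simp: card_2_iff)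
  then show thesis using that e by blast
qed

lemma ex_cycle_if_degree_ge_2:
  assumes graph: "simple_graph V E" and "V \<noteq> {}" and deg: "\<And>v. v \<in> V \<Longrightarrow> 2 \<le> degree E v"
  shows "\<exists>vs. cycle_in E vs"
proof -
  obtain x xs where x: "x \<in> V" and path: "distinct (x # xs)" "path_edges (x # xs) \<subseteq> E"
    and nbrs: "{w. {x, w} \<in> E} \<subseteq> set xs"
    using obtain_path_without_extension[OF graph \<open>V \<noteq> {}\<close>] .
  obtain w where w: "{x, w} \<in> E" "w \<noteq> hd xs"
    using obtain_second_neighbour[OF graph deg[OF x]] .
  obtain us ws where xs: "xs = us @ w # ws" using nbrs w split_list[of w xs] by blast
  moreover have "us \<noteq> []" using w xs by auto
  ultimately have "cycle_in E (x # us @ [w])"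
    using path w by (intro cycle_in_of_path_and_chord[of x us w ws]) auto
  then show ?thesis ..
qed

lemma card_edges_acyclic:
  assumes "simple_graph V E" "V \<noteq> {}" "\<nexists>vs. cycle_in E vs"
  shows "card E < card V"
  using assms
proof (induction "card V" arbitrary: V E rule: less_induct)
  case less
  note graph = less.prems(1)
  have fin: "finite V" "finite E"
    using graph simple_graph_finite_edges[OF graph] by (simp_all add: simple_graph_def)
  obtain v where v: "v \<in> V" "degree E v < 2"
    using ex_cycle_if_degree_ge_2[OF graph less.prems(2)] less.prems(3) not_le by blast
  have "card (V - {v}) < card V" using v fin by (intro psubset_card_mono) auto
  show ?case
  proof (cases "V = {v}")
    case True
    then have "e \<subseteq> {v} \<and> card e = 2" if "e \<in> E" for e
      using graph that by (simp add: simple_graph_def)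
    then have "e \<notin> E" for e using card_mono[of "{v}" e] by fastforce
    then have "E = {}" by blast
    then show ?thesis using True by simp
  next
    case False
    have "card (induced E (V - {v})) < card (V - {v})"
    proof (rule less.hyps)
      show "simple_graph (V - {v}) (induced E (V - {v}))"
        using graph by (intro simple_graph_induced) auto
      show "\<nexists>vs. cycle_in (induced E (V - {v})) vs"
        using less.prems(3) by (auto simp: cycle_in_def induced_def)
    qed (use False v \<open>card (V - {v}) < card V\<close> in auto)
    moreover have "card E \<le> card (induced E (V - {v}) \<union> {e \<in> E. v \<in> e})"
      using fin graph by (intro card_mono) (auto simp: induced_def simple_graph_def)
    moreover have "\<dots> \<le> card (induced E (V - {v})) + degree E v"
      unfolding degree_def by (rule card_Un_le)
    ultimately show ?thesis using v \<open>card (V - {v}) < card V\<close> by linarith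
  qed
qed

section \<open>Ears\<close>

definition ear :: "'a set set \<Rightarrow> 'a set \<Rightarrow> 'a set \<Rightarrow> 'a \<Rightarrow> 'a list \<Rightarrow> 'a \<Rightarrow> bool" where
  "ear D W S a ps b \<longleftrightarrow> a \<in> S \<and> b \<in> S \<and> a \<noteq> b \<and> distinct ps \<and> set ps \<subseteq> W \<and>
     path_edges (a # ps @ [b]) \<subseteq> D"

definition linked :: "'a set set \<Rightarrow> 'a set \<Rightarrow> 'a rel" where
  "linked D W = {(u, v). u \<in> W \<and> v \<in> W \<and> {u, v} \<in> D}\<^sup>* \<inter> W \<times> W"

definition attachments :: "'a set set \<Rightarrow> 'a set \<Rightarrow> 'a set \<Rightarrow> 'a set" where
  "attachments D S K = {s \<in> S. \<exists>y\<in>K. {y, s} \<in> D}"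

lemma equiv_linked: "equiv W (linked D W)"
proof (rule equivI)
  show "sym (linked D W)"
    unfolding linked_def by (intro sym_Int sym_rtrancl) (auto simp: sym_def insert_commute)
  show "trans (linked D W)"
    unfolding linked_def by (intro trans_Int trans_rtrancl) (auto simp: trans_def)
qed (auto simp: linked_def refl_on_def)

lemma linked_imp_simple_path:
  assumes "(x, y) \<in> linked D W"
  obtains ps where "distinct ps" "ps \<noteq> []" "hd ps = x" "last ps = y"
    "set ps \<subseteq> W" "path_edges ps \<subseteq> D"
proof -
  have "(x, y) \<in> {(u, v). u \<in> W \<and> v \<in> W \<and> {u, v} \<in> D}\<^sup>*" "x \<in> W"
    using assms by (auto simp: linked_def)
  then have "\<exists>ps. distinct ps \<and> ps \<noteq> [] \<and> hd ps = x \<and> last ps = y \<and> set ps \<subseteq> W \<and> path_edges ps \<subseteq> D"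
  proof (induction rule: rtrancl_induct)
    case base
    then show ?case by (intro exI[of _ "[x]"]) simp
  next
    case (step y z)
    then obtain ps where ps: "distinct ps" "ps \<noteq> []" "hd ps = x" "last ps = y" "set ps \<subseteq> W"
      "path_edges ps \<subseteq> D" by blast
    show ?case
    proof (cases "z \<in> set ps")
      case True
      then obtain us ws where us: "ps = us @ z # ws" using split_list by metis
      then have "path_edges (us @ [z]) \<subseteq> D" "hd (us @ [z]) = x"
        using ps(3,6) path_edges_append[of us z ws] by (simp_all, cases us) auto
      then show ?thesis using ps(1,5) us by (intro exI[of _ "us @ [z]"]) simp
    next
      case False
      then show ?thesis
        using ps step.hyps(2) by (intro exI[of _ "ps @ [z]"]) (simp add: path_edges_snoc)
    qed
  qed
  then show thesis using that by blast
qed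

lemma attachments_unique:
  assumes noear: "\<nexists>a ps b. ear D W S a ps b" and K: "K \<in> W // linked D W"
    and s: "s \<in> attachments D S K" and s': "s' \<in> attachments D S K"
  shows "s = s'"
proof (rule ccontr)
  assume "s \<noteq> s'"
  obtain y y' where y: "y \<in> K" "{y, s} \<in> D" "y' \<in> K" "{y', s'} \<in> D"
    using s s' by (auto simp: attachments_def)
  then have "(y, y') \<in> linked D W"
    using quotient_eq_iff[OF equiv_linked K K] by blast
  then obtain ps where ps: "distinct ps" "ps \<noteq> []" "hd ps = y" "last ps = y'" "set ps \<subseteq> W"
    "path_edges ps \<subseteq> D" by (rule linked_imp_simple_path)
  have "path_edges (s # ps @ [s']) = insert {s, y} (insert {y', s'} (path_edges ps))"
    using ps by (simp add: path_edges_Cons path_edges_snoc hd_append)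
  then have "ear D W S s ps s'"
    using ps y s s' \<open>s \<noteq> s'\<close> by (simp add: ear_def attachments_def insert_commute)
  then show False using noear by blast
qed

lemma card_attachments_le_1:
  assumes "\<nexists>a ps b. ear D W S a ps b" "K \<in> W // linked D W"
  shows "finite (attachments D S K)" "card (attachments D S K) \<le> 1"
proof -
  have "attachments D S K \<subseteq> {SOME s. s \<in> attachments D S K}"
    using attachments_unique[OF assms] by (metis singletonI someI subsetI)
  then show "finite (attachments D S K)" "card (attachments D S K) \<le> 1"
    by (auto intro: finite_subset dest: card_mono[rotated])
qed

lemma edge_subset_component_attachments:
  assumes K: "K \<in> W // linked D W" and e: "e \<in> D" "e \<subseteq> W \<union> S" "card e = 2"
    and y: "y \<in> e" "y \<in> K"
  shows "e \<subseteq> K \<union> attachments D S K"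
proof -
  obtain z where z: "e = {y, z}" using e(3) y(1) by (auto simp: card_2_iff)
  have "z \<in> K" if "z \<in> W"
  proof -
    have "y \<in> W" using in_quotient_imp_subset[OF equiv_linked K] y(2) by blast
    then have "(y, z) \<in> linked D W" using that e(1) z by (auto simp: linked_def)
    then show ?thesis using in_quotient_imp_closed[OF equiv_linked K y(2)] by blast
  qed
  then show ?thesis using e y z by (auto simp: attachments_def)
qed

lemma edges_covered_by_components:
  assumes edge: "\<And>e. e \<in> D \<Longrightarrow> e \<subseteq> W \<union> S \<and> card e = 2" and noear: "\<nexists>a ps b. ear D W S a ps b"
  shows "D \<subseteq> (\<Union>K \<in> W // linked D W. induced D (K \<union> attachments D S K))"
proof
  fix e assume e: "e \<in> D"
  then obtain a b where ab: "e = {a, b}" "a \<noteq> b" using edge[OF e] by (auto simp: card_2_iff)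
  have "\<not> ear D W S a [] b" using noear by blast
  then have "\<not> e \<subseteq> S" using e ab by (auto simp: ear_def)
  then obtain y where y: "y \<in> e" "y \<in> W" using edge[OF e] by blast
  then obtain K where K: "K \<in> W // linked D W" "y \<in> K"
    using Union_quotient[OF equiv_linked, of W D] by blast
  then have "e \<subseteq> K \<union> attachments D S K"
    using edge_subset_component_attachments[OF K(1) e _ _ y(1) K(2)] edge[OF e] by blast
  then show "e \<in> (\<Union>K \<in> W // linked D W. induced D (K \<union> attachments D S K))"
    using K(1) e by (auto simp: induced_def)
qed

lemma card_component_edges:
  assumes W: "finite W" "W \<inter> S = {}" and noear: "\<nexists>a ps b. ear D W S a ps b"
    and K: "K \<in> W // linked D W"
    and sparse: "\<And>X. X \<subseteq> W \<union> S \<Longrightarrow> finite X \<Longrightarrow> X \<noteq> {} \<Longrightarrow> card (X \<inter> S) \<le> 1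
      \<Longrightarrow> d * card (induced D X) + g \<le> g * card X"
  shows "d * card (induced D (K \<union> attachments D S K)) \<le> g * card K"
proof -
  let ?X = "K \<union> attachments D S K"
  have component: "K \<subseteq> W" "K \<noteq> {}"
    using in_quotient_imp_subset[OF equiv_linked K] in_quotient_imp_non_empty[OF equiv_linked K] .
  note attached = card_attachments_le_1[OF noear K]
  have "attachments D S K \<subseteq> S" by (auto simp: attachments_def)
  then have "?X \<inter> S = attachments D S K" using component W(2) by blast
  then have "d * card (induced D ?X) + g \<le> g * card ?X"
    using component attached finite_subset[OF component(1) W(1)] \<open>attachments D S K \<subseteq> S\<close>
    by (intro sparse) auto
  also have "\<dots> \<le> g * (card K + 1)"
    using card_Un_le[of K "attachments D S K"] attached(2) by (intro mult_le_mono2) linarith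
  finally show ?thesis by simp
qed

text \<open>Without ears, every component of \<open>W\<close> is attached to at most one vertex of \<open>S\<close>, so that the
  local sparsity assumption can be summed over the components.\<close>

lemma card_edges_without_ear:
  assumes fin: "finite W" "finite D" and edge: "\<And>e. e \<in> D \<Longrightarrow> e \<subseteq> W \<union> S \<and> card e = 2"
    and disj: "W \<inter> S = {}" and noear: "\<nexists>a ps b. ear D W S a ps b"
    and sparse: "\<And>X. X \<subseteq> W \<union> S \<Longrightarrow> finite X \<Longrightarrow> X \<noteq> {} \<Longrightarrow> card (X \<inter> S) \<le> 1
      \<Longrightarrow> d * card (induced D X) + g \<le> g * card X"
  shows "d * card D \<le> g * card W"
proof -
  let ?Q = "W // linked D W" and ?X = "\<lambda>K. K \<union> attachments D S K"
  have finQ: "finite ?Q" using fin(1) by (intro finite_quotient) (auto simp: linked_def)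
  have "card D \<le> card (\<Union>K\<in>?Q. induced D (?X K))"
    using edges_covered_by_components[OF edge noear] fin(2) finQ
    by (intro card_mono) (auto simp: induced_def)
  also have "\<dots> \<le> (\<Sum>K\<in>?Q. card (induced D (?X K)))" using finQ by (rule card_UN_le)
  finally have "d * card D \<le> (\<Sum>K\<in>?Q. d * card (induced D (?X K)))"
    by (metis mult_le_mono2 sum_distrib_left)
  also have "\<dots> \<le> (\<Sum>K\<in>?Q. g * card K)"
    using card_component_edges[OF fin(1) disj noear _ sparse] by (rule sum_mono)
  also have "\<dots> = g * (\<Sum>K\<in>?Q. card K)" by (simp add: sum_distrib_left)
  also have "(\<Sum>K\<in>?Q. card K) = card (\<Union>?Q)"
  proof (rule card_Union_disjoint[symmetric])
    show "pairwise disjnt ?Q"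
      using quotient_disj[OF equiv_linked] unfolding pairwise_def disjnt_def by blast
    show "finite K" if "K \<in> ?Q" for K
      using in_quotient_imp_subset[OF equiv_linked that] fin(1) by (rule finite_subset)
  qed
  also have "\<Union>?Q = W" by (rule Union_quotient[OF equiv_linked])
  finally show ?thesis .
qed

section \<open>Topology of the plane\<close>

lemma interior_arc_image:
  fixes g :: "real \<Rightarrow> complex"
  assumes "arc g"
  shows "interior (path_image g) = {}"
proof (rule ccontr)
  assume nonempty: "interior (path_image g) \<noteq> {}"
  obtain h where h: "homeomorphism {0..1} (path_image g) g h"
    using homeomorphism_arc[OF assms] by blast
  have "continuous_on (interior (path_image g)) h" "inj_on h (interior (path_image g))"
    using h interior_subset[of "path_image g"]
    by (auto simp: homeomorphism_def subset_iff
        intro: continuous_on_subset intro!: inj_on_inverseI[of _ g])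
  then have "DIM(complex) \<le> DIM(real)"
    using invariance_of_dimension[of "interior (path_image g)" h] nonempty by simp
  then show False by simp
qed

lemma connected_meets_inside_subset:
  assumes "connected T" "T \<inter> S = {}" "x \<in> T" "x \<in> inside S"
  shows "T \<subseteq> inside S"
  using inside_outside_intersect_connected[OF assms(1), of S] assms(2-4) union_with_inside[of S]
  by blast

lemma connected_unbounded_subset_outside:
  fixes T :: "'a::real_normed_vector set"
  assumes "connected T" "T \<inter> S = {}" "\<not> bounded T"
  shows "T \<subseteq> outside S"
proof
  fix y assume y: "y \<in> T"
  then have "T \<subseteq> connected_component_set (- S) y"
    using assms by (intro connected_component_maximal) auto
  then have "\<not> bounded (connected_component_set (- S) y)"
    using assms(3) bounded_subset by blast
  then show "y \<in> outside S" using y assms(2) by (auto simp: outside_def)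
qed

lemma arc_image_subset_inside_Un:
  fixes g :: "real \<Rightarrow> 'a::real_normed_vector"
  assumes "arc g" "closed S" "0 < t" "t < 1" "g t \<in> inside S"
    and ends: "path_image g \<inter> S \<subseteq> {pathstart g, pathfinish g}"
  shows "path_image g \<subseteq> inside S \<union> S"
proof -
  define T where "T = g ` {0<..<1}"
  have inj: "inj_on g {0..1}" and cont: "continuous_on {0..1} g"
    using \<open>arc g\<close> by (auto simp: arc_def path_def)
  have "connected T"
    unfolding T_def using cont
    by (intro connected_continuous_image) (auto intro: continuous_on_subset)
  moreover have "T \<inter> S = {}"
  proof -
    have "g s \<noteq> g 0" "g s \<noteq> g 1" if "s \<in> {0<..<1}" for s
      using that inj_onD[OF inj, of s 0] inj_onD[OF inj, of s 1] by auto
    then have "g 0 \<notin> T" "g 1 \<notin> T" unfolding T_def by (metis imageE)+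
    moreover have "T \<subseteq> path_image g" by (auto simp: T_def path_image_def)
    ultimately show ?thesis using ends unfolding pathstart_def pathfinish_def by blast
  qed
  ultimately have "T \<subseteq> inside S"
    using assms(3-5) by (intro connected_meets_inside_subset[of _ _ "g t"]) (auto simp: T_def)
  then have "closure T \<subseteq> inside S \<union> S"
    using closure_mono[of T "inside S"] closure_inside_subset[OF \<open>closed S\<close>] by blast
  moreover have "path_image g \<subseteq> closure T"
    using image_closure_subset[of "{0<..<1}" g "closure T"] cont closure_subset[of T]
    by (simp add: path_image_def T_def)
  ultimately show ?thesis by blast
qed

definition inversion :: "complex \<Rightarrow> complex \<Rightarrow> complex" where
  "inversion a z = inverse (z - a)"

lemma inj_inversion: "inj (inversion a)"
  by (auto simp: inj_def inversion_def)

lemma continuous_on_inversion: "a \<notin> A \<Longrightarrow> continuous_on A (inversion a)"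
  unfolding inversion_def by (intro continuous_intros) auto

lemma inversion_image_disjoint: "A \<inter> B = {} \<Longrightarrow> inversion a ` A \<inter> inversion a ` B = {}"
  by (simp flip: image_Int[OF inj_inversion])

lemma unbounded_inversion_image:
  assumes "open U" "a \<in> U"
  shows "\<not> bounded (inversion a ` (U - {a}))"
proof
  assume "bounded (inversion a ` (U - {a}))"
  then obtain B where B: "\<And>z. z \<in> U - {a} \<Longrightarrow> norm (inversion a z) \<le> B"
    by (auto simp: bounded_iff)
  have "filterlim (inversion a) at_infinity (at a)"
    unfolding inversion_def
    by (rule filterlim_compose[OF filterlim_inverse_at_infinity])
      (auto simp: filterlim_at eventually_at_filter intro!: tendsto_eq_intros)
  then have "eventually (\<lambda>z. B + 1 \<le> norm (inversion a z)) (at a)"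
    using filterlim_at_infinity_imp_norm_at_top[of "inversion a"]
    unfolding filterlim_at_top by blast
  moreover have "eventually (\<lambda>z. z \<in> U - {a}) (at a)"
    using eventually_at_in_open[OF assms] .
  ultimately have "eventually (\<lambda>z. False) (at a)"
    by eventually_elim (use B in fastforce)
  then show False by simp
qed

lemma inversion_inside_subset_outside:
  assumes c: "simple_path c" "pathfinish c = pathstart c" and a: "a \<in> inside (path_image c)"
  shows "inversion a ` (inside (path_image c) - {a}) \<subseteq> outside (inversion a ` path_image c)"
proof (rule connected_unbounded_subset_outside)
  have inside: "open (inside (path_image c))" "connected (inside (path_image c))"
    using Jordan_inside_outside[OF c] by blast+
  then show "connected (inversion a ` (inside (path_image c) - {a}))"
    by (intro connected_continuous_image continuous_on_inversion connected_open_delete) auto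
  show "inversion a ` (inside (path_image c) - {a}) \<inter> inversion a ` path_image c = {}"
    using inside_no_overlap[of "path_image c"] by (intro inversion_image_disjoint) blast
  show "\<not> bounded (inversion a ` (inside (path_image c) - {a}))"
    by (rule unbounded_inversion_image[OF inside(1) a])
qed

text \<open>The inside of the inverted curve is a nonempty open set, hence contains the image of some
  point other than \<open>a\<close>; by the previous lemma that point was outside the curve.\<close>

lemma inversion_outside_subset_inside:
  assumes c: "simple_path c" "pathfinish c = pathstart c" and a: "a \<in> inside (path_image c)"
  shows "inversion a ` outside (path_image c) \<subseteq> inside (inversion a ` path_image c)"
proof -
  note jordan = Jordan_inside_outside[OF c]
  have off: "a \<notin> outside (path_image c)" "a \<notin> path_image c" using a jordan by blast+
  have "simple_path (inversion a \<circ> c)" "pathfinish (inversion a \<circ> c) = pathstart (inversion a \<circ> c)"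
    using c off inj_on_subset[OF inj_inversion]
    by (auto intro!: simple_path_continuous_image continuous_on_inversion
        simp: pathfinish_compose pathstart_compose)
  note jordan' = Jordan_inside_outside[OF this, unfolded path_image_compose]
  have "open (inside (inversion a ` path_image c))" "inside (inversion a ` path_image c) \<noteq> {}"
    using jordan' by blast+
  then have "\<not> inside (inversion a ` path_image c) \<subseteq> {0}"
    by (metis finite.emptyI finite_insert finite_subset not_open_singleton subset_singletonD)
  then obtain y where y: "y \<in> inside (inversion a ` path_image c)" "y \<noteq> 0" by blast
  define z where "z = a + inverse y"
  have z: "inversion a z = y" "z \<noteq> a" using y by (auto simp: z_def inversion_def)
  have "z \<in> outside (path_image c)"
  proof (rule ccontr)
    assume "z \<notin> outside (path_image c)"
    then have "z \<in> inside (path_image c) - {a} \<or> z \<in> path_image c" using z jordan by blast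
    then have "y \<in> outside (inversion a ` path_image c) \<or> y \<in> inversion a ` path_image c"
      using inversion_inside_subset_outside[OF c a] z by blast
    then show False using y jordan' by blast
  qed
  moreover have "connected (inversion a ` outside (path_image c))"
    using jordan off by (intro connected_continuous_image continuous_on_inversion) auto
  moreover have "inversion a ` outside (path_image c) \<inter> inversion a ` path_image c = {}"
    by (intro inversion_image_disjoint) simp
  ultimately show ?thesis
    using y z by (intro connected_meets_inside_subset[of _ _ y]) auto
qed

lemma inversion_in_inside_iff:
  assumes c: "simple_path c" "pathfinish c = pathstart c" and a: "a \<in> inside (path_image c)"
    and "z \<noteq> a"
  shows "inversion a z \<in> inside (inversion a ` path_image c) \<longleftrightarrow> z \<in> outside (path_image c)"
proof
  assume in_inside: "inversion a z \<in> inside (inversion a ` path_image c)"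
  then have "inversion a z \<notin> outside (inversion a ` path_image c)"
    "inversion a z \<notin> inversion a ` path_image c"
    using inside_Int_outside inside_no_overlap by blast+
  then have "z \<notin> inside (path_image c)" "z \<notin> path_image c"
    using inversion_inside_subset_outside[OF c a] \<open>z \<noteq> a\<close> by blast+
  then show "z \<in> outside (path_image c)" using union_with_inside[of "path_image c"] by blast
qed (use inversion_outside_subset_inside[OF c a] in blast)

section \<open>Plane drawings\<close>

locale plane_drawing =
  fixes V :: "'a set" and E :: "'a set set"
    and pos :: "'a \<Rightarrow> complex" and arcs :: "'a set \<Rightarrow> real \<Rightarrow> complex"
  assumes graph: "simple_graph V E"
    and inj_pos: "inj_on pos V"
    and arc_arcs: "e \<in> E \<Longrightarrow> arc (arcs e)"
    and arc_ends: "e \<in> E \<Longrightarrow> {pathstart (arcs e), pathfinish (arcs e)} = pos ` e"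
    and arc_vertices: "e \<in> E \<Longrightarrow> path_image (arcs e) \<inter> pos ` V = pos ` e"
    and arcs_meet: "e \<in> E \<Longrightarrow> e' \<in> E \<Longrightarrow> e \<noteq> e' \<Longrightarrow>
          path_image (arcs e) \<inter> path_image (arcs e') \<subseteq> pos ` (e \<inter> e')"

lemma planar_imp_plane_drawing:
  fixes V :: "'a set"
  assumes "planar V E" "simple_graph V E"
  obtains pos arcs where "plane_drawing V E pos arcs"
proof -
  obtain pos :: "'a \<Rightarrow> complex" and arcs where inj: "inj_on pos V"
    and ends: "\<forall>e\<in>E. arc (arcs e) \<and> {pathstart (arcs e), pathfinish (arcs e)} = pos ` e \<and>
                path_image (arcs e) \<inter> pos ` V = pos ` e"
    and meet: "\<forall>e\<in>E. \<forall>e'\<in>E. e \<noteq> e' \<longrightarrow>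
                path_image (arcs e) \<inter> path_image (arcs e') \<subseteq> pos ` (e \<inter> e')"
    using assms(1) unfolding planar_def by blast
  have "plane_drawing V E pos arcs"
    by unfold_locales (use assms(2) inj bspec[OF ends] bspec[OF bspec[OF meet]] in simp_all)
  then show thesis by (rule that)
qed

context plane_drawing
begin

lemma finite_V: "finite V" and edge_subset: "e \<in> E \<Longrightarrow> e \<subseteq> V" and edge_card: "e \<in> E \<Longrightarrow> card e = 2"
  using graph by (auto simp: simple_graph_def)

lemma finite_E: "finite E"
  by (rule simple_graph_finite_edges[OF graph])

lemma plane_drawing_induced:
  assumes "X \<subseteq> V"
  shows "plane_drawing X (induced E X) pos arcs"
proof
  show "simple_graph X (induced E X)" using graph assms by (rule simple_graph_induced)
  show "inj_on pos X" using inj_pos assms by (rule inj_on_subset)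
  show "path_image (arcs e) \<inter> pos ` X = pos ` e" if "e \<in> induced E X" for e
    using arc_vertices[of e] assms that unfolding induced_def by blast
qed (use arc_arcs arc_ends arcs_meet in \<open>auto simp: induced_def\<close>)

text \<open>The midpoint of an edge decides on which side of a cycle the edge lies.\<close>

definition mid :: "'a set \<Rightarrow> complex" where
  "mid e = arcs e (1/2)"

definition trace :: "'a set set \<Rightarrow> complex set" where
  "trace F = (\<Union>e\<in>F. path_image (arcs e))"

definition inner_edges :: "'a set set \<Rightarrow> 'a set set" where
  "inner_edges C = {e \<in> E. mid e \<in> inside (trace C)}"

definition inner_vertices :: "'a set set \<Rightarrow> 'a set" where
  "inner_vertices C = {v \<in> V. pos v \<in> inside (trace C)}"

definition outer_edges :: "'a set set \<Rightarrow> 'a set set" where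
  "outer_edges C = {e \<in> E. mid e \<in> outside (trace C)}"

definition outer_vertices :: "'a set set \<Rightarrow> 'a set" where
  "outer_vertices C = {v \<in> V. pos v \<in> outside (trace C)}"

lemma finite_inner_edges: "finite (inner_edges C)"
  and finite_inner_vertices: "finite (inner_vertices C)"
  and finite_outer_vertices: "finite (outer_vertices C)"
  using finite_E finite_V
  by (auto simp: inner_edges_def inner_vertices_def outer_vertices_def)

lemma trace_Un: "trace (F \<union> G) = trace F \<union> trace G"
  by (auto simp: trace_def)

lemma closed_trace:
  assumes "F \<subseteq> E"
  shows "closed (trace F)"
  unfolding trace_def using assms finite_subset[OF assms finite_E] arc_arcs
  by (intro closed_UN) (auto intro: closed_arc_image)

lemma mid_in_image: "mid e \<in> path_image (arcs e)"
  by (auto simp: mid_def path_image_def)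

lemma mid_not_vertex:
  assumes "e \<in> E" shows "mid e \<notin> pos ` V"
proof
  assume "mid e \<in> pos ` V"
  then have "mid e \<in> pos ` e" using arc_vertices[OF assms] mid_in_image by blast
  then have "arcs e (1/2) = arcs e 0 \<or> arcs e (1/2) = arcs e 1"
    using arc_ends[OF assms] by (auto simp: mid_def pathstart_def pathfinish_def)
  then show False
    using arc_imp_inj_on[OF arc_arcs[OF assms]] by (auto dest: inj_onD)
qed

lemma mid_in_trace_iff:
  assumes "e \<in> E" "F \<subseteq> E"
  shows "mid e \<in> trace F \<longleftrightarrow> e \<in> F"
proof
  assume "mid e \<in> trace F"
  then obtain f where f: "f \<in> F" "mid e \<in> path_image (arcs f)" by (auto simp: trace_def)
  show "e \<in> F"
  proof (rule ccontr)
    assume "e \<notin> F"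
    then have "mid e \<in> pos ` (e \<inter> f)"
      using f assms arcs_meet[of e f] mid_in_image[of e] by blast
    then show False using mid_not_vertex[OF assms(1)] edge_subset[OF assms(1)] by blast
  qed
qed (use mid_in_image in \<open>auto simp: trace_def\<close>)

lemma pos_in_trace_iff:
  assumes "v \<in> V" "F \<subseteq> E"
  shows "pos v \<in> trace F \<longleftrightarrow> v \<in> \<Union>F"
proof
  assume "pos v \<in> trace F"
  then obtain f where f: "f \<in> F" "pos v \<in> path_image (arcs f)" by (auto simp: trace_def)
  then have "pos v \<in> pos ` f" using assms arc_vertices[of f] by blast
  then show "v \<in> \<Union>F"
    using inj_pos f assms edge_subset[of f] by (metis UnionI inj_on_image_mem_iff subsetD)
next
  assume "v \<in> \<Union>F"
  then obtain f where f: "f \<in> F" "v \<in> f" by blast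
  then have "pos v \<in> path_image (arcs f)" using assms arc_vertices[of f] by blast
  then show "pos v \<in> trace F" using f by (auto simp: trace_def)
qed

lemma trace_Int_subset:
  assumes "F \<subseteq> E" "G \<subseteq> E" "F \<inter> G = {}"
  shows "trace F \<inter> trace G \<subseteq> pos ` (\<Union>F \<inter> \<Union>G)"
proof
  fix x assume "x \<in> trace F \<inter> trace G"
  then obtain f g where fg: "f \<in> F" "g \<in> G" "x \<in> path_image (arcs f)" "x \<in> path_image (arcs g)"
    by (auto simp: trace_def)
  then have "x \<in> pos ` (f \<inter> g)" using arcs_meet[of f g] assms by blast
  then show "x \<in> pos ` (\<Union>F \<inter> \<Union>G)" using fg by blast
qed

lemma edges_trichotomy: "C \<subseteq> E \<Longrightarrow> E = C \<union> inner_edges C \<union> outer_edges C"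
  using mid_in_trace_iff[of _ C] union_with_inside[of "trace C"]
  by (auto simp: inner_edges_def outer_edges_def)

lemma inner_edges_disjoint: "C \<subseteq> E \<Longrightarrow> inner_edges C \<inter> C = {}"
  using mid_in_trace_iff[of _ C] inside_no_overlap[of "trace C"]
  unfolding inner_edges_def by blast

lemma inner_vertices_disjoint: "C \<subseteq> E \<Longrightarrow> inner_vertices C \<inter> \<Union>C = {}"
  using pos_in_trace_iff[of _ C] inside_no_overlap[of "trace C"]
  unfolding inner_vertices_def by blast

lemma outer_vertices_disjoint: "C \<subseteq> E \<Longrightarrow> outer_vertices C \<inter> \<Union>C = {}"
  using pos_in_trace_iff[of _ C] outside_no_overlap[of "trace C"]
  unfolding outer_vertices_def by blast

lemma inner_outer_vertices_disjoint: "inner_vertices C \<inter> outer_vertices C = {}"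
  using inside_Int_outside[of "trace C"] unfolding inner_vertices_def outer_vertices_def by blast

lemma inner_edge_subset:
  assumes C: "C \<subseteq> E" and e: "e \<in> inner_edges C"
  shows "e \<subseteq> inner_vertices C \<union> \<Union>C"
proof
  fix v assume v: "v \<in> e"
  have eE: "e \<in> E" and inside: "mid e \<in> inside (trace C)" using e by (auto simp: inner_edges_def)
  have "path_image (arcs e) \<inter> trace C \<subseteq> pos ` e"
    using arcs_meet[OF eE] C inner_edges_disjoint[OF C] e by (fastforce simp: trace_def)
  then have "path_image (arcs e) \<subseteq> inside (trace C) \<union> trace C"
    using arc_image_subset_inside_Un[OF arc_arcs[OF eE] closed_trace[OF C], of "1/2"] inside
      arc_ends[OF eE] by (simp add: mid_def)
  moreover have "v \<in> V" "pos v \<in> path_image (arcs e)"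
    using v eE edge_subset arc_vertices by blast+
  ultimately show "v \<in> inner_vertices C \<union> \<Union>C"
    using pos_in_trace_iff[OF \<open>v \<in> V\<close> C] by (auto simp: inner_vertices_def)
qed

lemma arc_from_to:
  assumes "{x, y} \<in> E" "x \<noteq> y"
  obtains g where "arc g" "path_image g = path_image (arcs {x, y})"
    "pathstart g = pos x" "pathfinish g = pos y"
proof (cases "pathstart (arcs {x, y}) = pos x")
  case True
  have "pos y \<noteq> pos x" using inj_pos edge_subset[OF assms(1)] assms(2) by (auto dest: inj_onD)
  then have "pathfinish (arcs {x, y}) = pos y"
    using arc_ends[OF assms(1)] True by auto
  then show ?thesis using that[of "arcs {x, y}"] True arc_arcs assms by blast
next
  case False
  then have "pathstart (arcs {x, y}) = pos y" "pathfinish (arcs {x, y}) = pos x"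
    using arc_ends[OF assms(1)] by (auto simp: doubleton_eq_iff)
  then show ?thesis
    using that[of "reversepath (arcs {x, y})"] arc_arcs[OF assms(1)] by (simp add: arc_reversepath)
qed

lemma ex_arc_of_path:
  assumes "distinct xs" "length xs \<ge> 2" "path_edges xs \<subseteq> E"
  shows "\<exists>g. arc g \<and> path_image g = trace (path_edges xs) \<and>
    pathstart g = pos (hd xs) \<and> pathfinish g = pos (last xs)"
  using assms
proof (induction xs rule: path_edges.induct)
  case (1 x y zs)
  then have xy: "{x, y} \<in> E" "x \<noteq> y" by auto
  obtain g where g: "arc g" "path_image g = path_image (arcs {x, y})"
    "pathstart g = pos x" "pathfinish g = pos y"
    using arc_from_to[OF xy] .
  show ?case
  proof (cases "zs = []")
    case True
    then show ?thesis using g by (intro exI[of _ g]) (simp add: trace_def)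
  next
    case False
    then obtain h where h: "arc h" "path_image h = trace (path_edges (y # zs))"
      "pathstart h = pos y" "pathfinish h = pos (last zs)"
      using 1 by (cases zs) auto
    have "trace {{x, y}} \<inter> trace (path_edges (y # zs)) \<subseteq>
          pos ` (\<Union>{{x, y}} \<inter> \<Union>(path_edges (y # zs)))"
      using 1 path_edges_subset[of "{x, y}" "y # zs"] by (intro trace_Int_subset) auto
    also have "\<dots> \<subseteq> {pos y}"
      using 1 path_edges_subset[of _ "y # zs"] by auto
    finally have "path_image g \<inter> path_image h \<subseteq> {pathstart h}"
      using g h by (simp add: trace_def)
    then have "arc (g +++ h)" using g h by (intro arc_join) auto
    moreover have "path_image (g +++ h) = trace (path_edges (x # y # zs))"
      using g h by (simp add: path_image_join trace_def)
    ultimately show ?thesis using g h False by (intro exI[of _ "g +++ h"]) auto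
  qed
qed auto

lemma obtain_arc_of_path:
  assumes "distinct (a # xs @ [b])" "path_edges (a # xs @ [b]) \<subseteq> E"
  obtains g where "arc g" "path_image g = trace (path_edges (a # xs @ [b]))"
    "pathstart g = pos a" "pathfinish g = pos b"
  using ex_arc_of_path[OF assms(1) _ assms(2)] by auto

lemma cycle_paths_trace_Int:
  assumes "cycle_in E (a # xs @ b # ys)"
  shows "trace (path_edges (a # xs @ [b])) \<inter> trace (path_edges (b # ys @ [a])) = {pos a, pos b}"
    (is "trace ?F \<inter> trace ?G = _")
proof
  have distinct: "distinct (a # xs @ b # ys)" and nonempty: "xs \<noteq> [] \<or> ys \<noteq> []"
    and subset: "?F \<subseteq> E" "?G \<subseteq> E"
    using assms unfolding cycle_in_def cycle_edges_split by auto
  have vertices: "\<Union>?F = set (a # xs @ [b])" "\<Union>?G = set (b # ys @ [a])"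
    by (rule Union_path_edges; simp)+
  have "\<Union>?F \<inter> \<Union>?G = {a, b}" unfolding vertices using distinct by auto
  then show "trace ?F \<inter> trace ?G \<subseteq> {pos a, pos b}"
    using trace_Int_subset[OF subset cycle_paths_edge_disjoint[OF distinct nonempty]] by simp
  have "\<Union>?F \<subseteq> V" using subset edge_subset by blast
  then have "a \<in> V" "b \<in> V" unfolding vertices by auto
  then show "{pos a, pos b} \<subseteq> trace ?F \<inter> trace ?G"
    using pos_in_trace_iff subset vertices by auto
qed

lemma obtain_curve_of_cycle:
  assumes "cycle_in E vs"
  obtains c where "simple_path c" "pathfinish c = pathstart c"
    "path_image c = trace (cycle_edges vs)"
proof -
  obtain a xs b where vs: "vs = a # xs @ b # []"
    using assms by (cases vs; cases "tl vs" rule: rev_cases) (auto simp: cycle_in_def)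
  have C: "cycle_edges vs = path_edges (a # xs @ [b]) \<union> path_edges (b # [] @ [a])"
    unfolding vs by (rule cycle_edges_split)
  have distinct: "distinct (a # xs @ [b])" "distinct (b # [] @ [a])"
    and subset: "path_edges (a # xs @ [b]) \<subseteq> E" "path_edges (b # [] @ [a]) \<subseteq> E"
    using assms unfolding cycle_in_def C by (auto simp: vs)
  obtain g where g: "arc g" "path_image g = trace (path_edges (a # xs @ [b]))"
    "pathstart g = pos a" "pathfinish g = pos b"
    using obtain_arc_of_path[OF distinct(1) subset(1)] .
  obtain h where h: "arc h" "path_image h = trace (path_edges (b # [] @ [a]))"
    "pathstart h = pos b" "pathfinish h = pos a"
    using obtain_arc_of_path[OF distinct(2) subset(2)] .
  have "path_image g \<inter> path_image h = {pos a, pos b}"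
    unfolding g h using assms unfolding vs by (rule cycle_paths_trace_Int)
  then have "simple_path (g +++ h)" using g h by (intro simple_path_join_loop) auto
  moreover have "path_image (g +++ h) = trace (cycle_edges vs)"
    unfolding C trace_Un using g h by (simp add: path_image_join)
  ultimately show thesis using that[of "g +++ h"] g h by simp
qed

lemma interior_drawing_empty:
  assumes "F \<subseteq> E"
  shows "interior (trace F \<union> pos ` V) = {}"
proof -
  have "finite F" using assms finite_E by (rule finite_subset)
  then show ?thesis using assms
  proof (induction F rule: finite_induct)
    case empty
    then show ?case using finite_V by (simp add: trace_def empty_interior_finite)
  next
    case (insert e F)
    have trace_insert: "trace (insert e F) \<union> pos ` V = path_image (arcs e) \<union> (trace F \<union> pos ` V)"
      by (auto simp: trace_def)
    have "arc (arcs e)" using insert.prems arc_arcs by auto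
    then show ?case
      unfolding trace_insert
      using insert interior_arc_image[of "arcs e"] closed_arc_image[of "arcs e"]
      by (subst interior_closed_Un_empty_interior) auto
  qed
qed

lemma plane_drawing_image:
  assumes cont: "continuous_on (trace E) f" and inj: "inj_on f (trace E \<union> pos ` V)"
  shows "plane_drawing V E (f \<circ> pos) (\<lambda>e. f \<circ> arcs e)"
proof
  show "simple_graph V E" by (rule graph)
  show "inj_on (f \<circ> pos) V"
    using inj_pos inj by (auto intro: comp_inj_on inj_on_subset)
  have image_Int: "f ` A \<inter> f ` B = f ` (A \<inter> B)"
    if "A \<subseteq> trace E" "B \<subseteq> trace E \<union> pos ` V" for A B
    using inj_on_image_Int[OF inj, of A B] that by auto
  fix e assume e: "e \<in> E"
  have trace: "path_image (arcs e) \<subseteq> trace E" using e by (auto simp: trace_def)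
  show "arc (f \<circ> arcs e)"
    unfolding arc_def
  proof
    show "path (f \<circ> arcs e)"
      using arc_imp_path[OF arc_arcs[OF e]] continuous_on_subset[OF cont trace]
      by (rule path_continuous_image)
    show "inj_on (f \<circ> arcs e) {0..1}"
      using arc_imp_inj_on[OF arc_arcs[OF e]] trace inj
      by (auto simp: path_image_def intro!: comp_inj_on intro: inj_on_subset)
  qed
  show "{pathstart (f \<circ> arcs e), pathfinish (f \<circ> arcs e)} = (f \<circ> pos) ` e"
    using arg_cong[OF arc_ends[OF e], of "image f"]
    by (simp add: pathfinish_compose pathstart_compose image_comp)
  show "path_image (f \<circ> arcs e) \<inter> (f \<circ> pos) ` V = (f \<circ> pos) ` e"
    using image_Int[OF trace, of "pos ` V"] arc_vertices[OF e]
    unfolding path_image_compose image_comp[symmetric] by auto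
  fix e' assume e': "e' \<in> E" "e \<noteq> e'"
  then have "path_image (arcs e') \<subseteq> trace E" by (auto simp: trace_def)
  then show "path_image (f \<circ> arcs e) \<inter> path_image (f \<circ> arcs e') \<subseteq> (f \<circ> pos) ` (e \<inter> e')"
    using image_Int[OF trace, of "path_image (arcs e')"] image_mono[OF arcs_meet[OF e e'], of f]
    unfolding path_image_compose image_comp[symmetric] by (simp add: le_supI1)
qed

lemma obtain_inverted_drawing:
  assumes "cycle_in E vs"
  obtains pos' arcs' where "plane_drawing V E pos' arcs'"
    "plane_drawing.inner_edges E arcs' (cycle_edges vs) = outer_edges (cycle_edges vs)"
    "plane_drawing.inner_vertices V pos' arcs' (cycle_edges vs) = outer_vertices (cycle_edges vs)"
proof -
  let ?C = "cycle_edges vs"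
  obtain c where c: "simple_path c" "pathfinish c = pathstart c" "path_image c = trace ?C"
    using obtain_curve_of_cycle[OF assms] .
  have "open (inside (trace ?C))" "inside (trace ?C) \<noteq> {}"
    using Jordan_inside_outside[OF c(1,2)] by (auto simp: c(3))
  then have "\<not> inside (trace ?C) \<subseteq> trace E \<union> pos ` V"
    using interior_maximal interior_drawing_empty[of E] by blast
  then obtain a where a: "a \<in> inside (trace ?C)" "a \<notin> trace E" "a \<notin> pos ` V" by blast
  have draw: "plane_drawing V E (inversion a \<circ> pos) (\<lambda>e. inversion a \<circ> arcs e)"
    using a(2) continuous_on_inversion inj_on_subset[OF inj_inversion]
    by (intro plane_drawing_image) auto
  interpret inverted: plane_drawing V E "inversion a \<circ> pos" "\<lambda>e. inversion a \<circ> arcs e"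
    by (rule draw)
  have trace: "inverted.trace F = inversion a ` trace F" for F
    by (auto simp: inverted.trace_def trace_def path_image_compose)
  note side = inversion_in_inside_iff[OF c(1,2), unfolded c(3), OF a(1)]
  have "mid e \<noteq> a" if "e \<in> E" for e
    using that a(2) mid_in_image[of e] by (auto simp: trace_def)
  then have "inverted.inner_edges ?C = outer_edges ?C"
    using side unfolding inverted.inner_edges_def outer_edges_def trace
    by (auto simp: inverted.mid_def mid_def)
  moreover have "inverted.inner_vertices ?C = outer_vertices ?C"
    using side a(3) unfolding inverted.inner_vertices_def outer_vertices_def trace by force
  ultimately show thesis using that[OF draw] by blast
qed

end

section \<open>Splitting a cycle along an inner ear\<close>

locale eared_cycle = plane_drawing V E pos arcs
  for V :: "'a set" and E pos arcs +
  fixes a b :: 'a and xs ys ps :: "'a list"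
  assumes cycle: "cycle_in E (a # xs @ b # ys)"
    and ear: "ear (inner_edges (cycle_edges (a # xs @ b # ys)))
      (inner_vertices (cycle_edges (a # xs @ b # ys))) (set (a # xs @ b # ys)) a ps b"
begin

abbreviation "left_path \<equiv> path_edges (a # xs @ [b])"
abbreviation "right_path \<equiv> path_edges (b # ys @ [a])"
abbreviation "ear_path \<equiv> path_edges (a # ps @ [b])"
abbreviation "whole \<equiv> cycle_edges (a # xs @ b # ys)"
abbreviation "left \<equiv> cycle_edges (a # xs @ b # rev ps)"
abbreviation "right \<equiv> cycle_edges (b # ys @ a # ps)"

lemma ear_path_rev: "path_edges (b # rev ps @ [a]) = ear_path"
  using path_edges_rev[of "a # ps @ [b]"] by simp

lemma whole_eq: "whole = left_path \<union> right_path"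
  by (rule cycle_edges_split)

lemma left_eq: "left = left_path \<union> ear_path"
  unfolding cycle_edges_split ear_path_rev ..

lemma right_eq: "right = right_path \<union> ear_path"
  by (rule cycle_edges_split)

lemma whole_subset: "whole \<subseteq> E"
  using cycle by (simp add: cycle_in_def)

lemma ear_path_inner: "ear_path \<subseteq> inner_edges whole"
  using ear by (simp add: ear_def)

lemma ear_path_subset: "ear_path \<subseteq> E"
  using ear_path_inner by (auto simp: inner_edges_def)

lemma ear_vertices_off_cycle: "set ps \<inter> set (a # xs @ b # ys) = {}"
  using ear inner_vertices_disjoint[OF whole_subset]
  by (subst Union_cycle_edges[symmetric]) (auto simp: ear_def)

lemma chord_not_in_whole: "ps = [] \<Longrightarrow> {a, b} \<notin> whole"
  using ear_path_inner inner_edges_disjoint[OF whole_subset] by auto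

lemma left_cycle: "cycle_in E (a # xs @ b # rev ps)"
proof -
  have "distinct (a # xs @ b # rev ps)"
    using cycle ear ear_vertices_off_cycle by (auto simp: cycle_in_def ear_def)
  moreover have "xs \<noteq> [] \<or> ps \<noteq> []" using chord_not_in_whole by (auto simp: whole_eq)
  moreover have "left \<subseteq> E" using whole_subset ear_path_subset by (auto simp: whole_eq left_eq)
  ultimately show ?thesis by (auto simp: cycle_in_def Suc_le_eq)
qed

lemma right_cycle: "cycle_in E (b # ys @ a # ps)"
proof -
  have "distinct (b # ys @ a # ps)"
    using cycle ear ear_vertices_off_cycle by (auto simp: cycle_in_def ear_def)
  moreover have "ys \<noteq> [] \<or> ps \<noteq> []"
    using chord_not_in_whole by (auto simp: whole_eq insert_commute)
  moreover have "right \<subseteq> E" using whole_subset ear_path_subset by (auto simp: whole_eq right_eq)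
  ultimately show ?thesis by (auto simp: cycle_in_def Suc_le_eq)
qed

lemma ex_ear_edge: "\<exists>e. e \<in> ear_path"
  by (cases ps) auto

lemma inside_split:
  shows "inside (trace left) \<inter> inside (trace right) = {}"
    and "inside (trace left) \<union> inside (trace right) \<union> (trace ear_path - {pos a, pos b})
      = inside (trace whole)"
proof -
  have distinct: "distinct (a # xs @ [b])" "distinct (b # ys @ [a])" "distinct (a # ps @ [b])"
    using cycle right_cycle by (auto simp: cycle_in_def)
  have subset: "left_path \<subseteq> E" "right_path \<subseteq> E" using whole_subset by (auto simp: whole_eq)
  obtain c1 where c1: "arc c1" "path_image c1 = trace left_path"
    "pathstart c1 = pos a" "pathfinish c1 = pos b"
    using obtain_arc_of_path[OF distinct(1) subset(1)] .
  obtain c2 where c2: "arc c2" "path_image c2 = trace right_path"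
    "pathstart c2 = pos b" "pathfinish c2 = pos a"
    using obtain_arc_of_path[OF distinct(2) subset(2)] .
  obtain c where c: "arc c" "path_image c = trace ear_path"
    "pathstart c = pos a" "pathfinish c = pos b"
    using obtain_arc_of_path[OF distinct(3) ear_path_subset] .
  have ends: "pos a \<noteq> pos b" using arc_distinct_ends[OF c(1)] c by auto
  have meet: "trace left_path \<inter> trace right_path = {pos a, pos b}"
    "trace left_path \<inter> trace ear_path = {pos a, pos b}"
    "trace right_path \<inter> trace ear_path = {pos a, pos b}"
    using cycle_paths_trace_Int[OF cycle] cycle_paths_trace_Int[OF left_cycle]
      cycle_paths_trace_Int[OF right_cycle] by (auto simp: ear_path_rev)
  obtain e where e: "e \<in> ear_path" using ex_ear_edge by blast
  then have "mid e \<in> trace ear_path \<inter> inside (trace left_path \<union> trace right_path)"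
    using mid_in_trace_iff[of e ear_path] ear_path_subset ear_path_inner
    by (auto simp: inner_edges_def whole_eq trace_Un)
  then have nonempty: "path_image c \<inter> inside (path_image c1 \<union> path_image (reversepath c2)) \<noteq> {}"
    using c c1 c2 by auto
  show "inside (trace left) \<inter> inside (trace right) = {}"
    and "inside (trace left) \<union> inside (trace right) \<union> (trace ear_path - {pos a, pos b})
      = inside (trace whole)"
    using split_inside_simple_closed_curve[of c1 "pos a" "pos b" "reversepath c2" c,
        OF _ _ _ _ _ _ _ _ _ ends _ _ _ nonempty] c1 c2 c meet
    by (auto simp: arc_imp_simple_path arc_reversepath whole_eq left_eq right_eq trace_Un)
qed

lemma inner_edges_subset:
  "inner_edges whole \<subseteq> inner_edges left \<union> inner_edges right \<union> ear_path"
  using inside_split(2) mid_in_trace_iff[OF _ ear_path_subset] by (fastforce simp: inner_edges_def)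

lemma inner_edges_psubset:
  shows "inner_edges left \<subset> inner_edges whole" and "inner_edges right \<subset> inner_edges whole"
proof -
  obtain e where "e \<in> ear_path" using ex_ear_edge by blast
  then have "e \<in> inner_edges whole" "e \<notin> inner_edges left" "e \<notin> inner_edges right"
    using ear_path_inner inner_edges_disjoint[of left] inner_edges_disjoint[of right]
      left_cycle right_cycle left_eq right_eq unfolding cycle_in_def by blast+
  moreover have "inner_edges left \<subseteq> inner_edges whole" "inner_edges right \<subseteq> inner_edges whole"
    using inside_split(2) by (auto simp: inner_edges_def)
  ultimately show "inner_edges left \<subset> inner_edges whole" "inner_edges right \<subset> inner_edges whole"
    by blast+
qed

lemma card_inner_edges_split:
  "card (inner_edges whole) \<le> card (inner_edges left) + card (inner_edges right) + (length ps + 1)"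
proof -
  have "card (inner_edges whole) \<le> card (inner_edges left \<union> inner_edges right \<union> ear_path)"
    using inner_edges_subset finite_inner_edges finite_path_edges by (intro card_mono) auto
  also have "\<dots> \<le> card (inner_edges left) + card (inner_edges right) + card ear_path"
    by (meson add_le_mono card_Un_le le_refl order_trans)
  finally show ?thesis using card_path_edges[of "a # ps @ [b]"] by simp
qed

lemma card_inner_vertices_split:
  "card (inner_vertices left) + card (inner_vertices right) + length ps
    \<le> card (inner_vertices whole)"
proof -
  have disjoint: "inner_vertices left \<inter> inner_vertices right = {}"
    using inside_split(1) by (auto simp: inner_vertices_def)
  have "set ps \<subseteq> \<Union>left" "set ps \<subseteq> \<Union>right"
    by (subst Union_cycle_edges; auto)+
  then have off: "(inner_vertices left \<union> inner_vertices right) \<inter> set ps = {}"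
    using inner_vertices_disjoint left_cycle right_cycle unfolding cycle_in_def by blast
  have "card (inner_vertices left) + card (inner_vertices right) + length ps
      = card (inner_vertices left \<union> inner_vertices right) + card (set ps)"
    using disjoint finite_inner_vertices ear by (simp add: card_Un_disjoint distinct_card ear_def)
  also have "\<dots> = card (inner_vertices left \<union> inner_vertices right \<union> set ps)"
    using off finite_inner_vertices by (intro card_Un_disjoint[symmetric]) auto
  also have "\<dots> \<le> card (inner_vertices whole)"
    using inside_split(2) ear finite_inner_vertices
    by (intro card_mono) (auto simp: inner_vertices_def ear_def)
  finally show ?thesis .
qed

text \<open>From here on the bound for the girth is written \<open>d + 2\<close>, to avoid truncated subtraction.\<close>

lemma inner_bound_from_parts:
  assumes "d * card (inner_edges left) + (d + 2)
      \<le> (d + 2) * card (inner_vertices left) + length (a # xs @ b # rev ps)"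
    and "d * card (inner_edges right) + (d + 2)
      \<le> (d + 2) * card (inner_vertices right) + length (b # ys @ a # ps)"
  shows "d * card (inner_edges whole) + (d + 2)
    \<le> (d + 2) * card (inner_vertices whole) + length (a # xs @ b # ys)"
proof -
  have "d * card (inner_edges whole)
      \<le> d * (card (inner_edges left) + card (inner_edges right) + (length ps + 1))"
    by (rule mult_le_mono2[OF card_inner_edges_split])
  moreover have "(d + 2) * (card (inner_vertices left) + card (inner_vertices right) + length ps)
      \<le> (d + 2) * card (inner_vertices whole)"
    by (rule mult_le_mono2[OF card_inner_vertices_split])
  ultimately show ?thesis using assms by (simp add: algebra_simps)
qed

end

section \<open>The edge bound for planar graphs of given girth\<close>

definition proper_subgraphs_sparse :: "nat \<Rightarrow> 'a set \<Rightarrow> 'a set set \<Rightarrow> bool" where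
  "proper_subgraphs_sparse d V E \<longleftrightarrow>
     (\<forall>X. X \<subset> V \<longrightarrow> X \<noteq> {} \<longrightarrow> d * card (induced E X) + (d + 2) \<le> (d + 2) * card X)"

context plane_drawing
begin

lemma cycle_vertices_subset: "cycle_in E vs \<Longrightarrow> set vs \<subseteq> V"
  using Union_cycle_edges[of vs] edge_subset by (fastforce simp: cycle_in_def)

lemma card_inner_edges_le_if_no_ear:
  assumes sparse: "proper_subgraphs_sparse d V E" and cycle: "cycle_in E vs"
    and noear: "\<nexists>a ps b. ear (inner_edges (cycle_edges vs)) (inner_vertices (cycle_edges vs))
      (set vs) a ps b"
  shows "d * card (inner_edges (cycle_edges vs)) \<le> (d + 2) * card (inner_vertices (cycle_edges vs))"
proof (rule card_edges_without_ear[OF finite_inner_vertices finite_inner_edges _ _ noear])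
  let ?C = "cycle_edges vs"
  have C: "?C \<subseteq> E" "\<Union>?C = set vs"
    using cycle by (auto simp: cycle_in_def intro!: Union_cycle_edges)
  show "e \<subseteq> inner_vertices ?C \<union> set vs \<and> card e = 2" if "e \<in> inner_edges ?C" for e
    using inner_edge_subset[OF C(1) that] that edge_card C(2) by (auto simp: inner_edges_def)
  show "inner_vertices ?C \<inter> set vs = {}"
    using inner_vertices_disjoint[OF C(1)] C(2) by simp
  show "d * card (induced (inner_edges ?C) X) + (d + 2) \<le> (d + 2) * card X"
    if X: "X \<subseteq> inner_vertices ?C \<union> set vs" "X \<noteq> {}" "card (X \<inter> set vs) \<le> 1" for X
  proof -
    have "X \<noteq> V"
    proof
      assume "X = V"
      then have "X \<inter> set vs = set vs" using cycle_vertices_subset[OF cycle] by blast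
      then show False using X(3) cycle by (simp add: cycle_in_def distinct_card)
    qed
    then have "X \<subset> V"
      using X(1) cycle_vertices_subset[OF cycle] by (auto simp: inner_vertices_def)
    then have "d * card (induced E X) + (d + 2) \<le> (d + 2) * card X"
      using sparse X(2) by (simp add: proper_subgraphs_sparse_def)
    moreover have "card (induced (inner_edges ?C) X) \<le> card (induced E X)"
      using finite_E by (intro card_mono) (auto simp: inner_edges_def induced_def)
    ultimately show ?thesis by (meson add_le_mono1 le_trans mult_le_mono2)
  qed
qed

lemma card_inner_edges_le:
  assumes girth: "girth_at_least (d + 2) E" and sparse: "proper_subgraphs_sparse d V E"
    and "cycle_in E vs"
  shows "d * card (inner_edges (cycle_edges vs)) + (d + 2)
    \<le> (d + 2) * card (inner_vertices (cycle_edges vs)) + length vs"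
  using assms(3)
proof (induction "card (inner_edges (cycle_edges vs))" arbitrary: vs rule: less_induct)
  case less
  let ?C = "cycle_edges vs"
  show ?case
  proof (cases "\<exists>a ps b. ear (inner_edges ?C) (inner_vertices ?C) (set vs) a ps b")
    case True
    then obtain a ps b where ear: "ear (inner_edges ?C) (inner_vertices ?C) (set vs) a ps b"
      by blast
    then obtain xs ys where rotated: "cycle_edges (a # xs @ b # ys) = ?C"
      "distinct (a # xs @ b # ys)" "length (a # xs @ b # ys) = length vs"
      "set (a # xs @ b # ys) = set vs"
      using cycle_edges_rotate_to[of vs a b] less.prems by (auto simp: cycle_in_def ear_def)
    have cycle: "cycle_in E (a # xs @ b # ys)"
      using less.prems rotated(1-3) unfolding cycle_in_def by simp
    interpret eared_cycle V E pos arcs a b xs ys ps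
      by unfold_locales (use cycle ear in \<open>simp_all only: rotated\<close>)
    have "card (inner_edges left) < card (inner_edges ?C)"
      "card (inner_edges right) < card (inner_edges ?C)"
      using inner_edges_psubset
      by (simp_all add: rotated(1) psubset_card_mono[OF finite_inner_edges])
    then show ?thesis
      using inner_bound_from_parts[OF less.hyps[OF _ left_cycle] less.hyps[OF _ right_cycle]]
      unfolding rotated by blast
  next
    case False
    have "d + 2 \<le> length vs" using girth less.prems by (auto simp: girth_at_least_def)
    then show ?thesis
      using card_inner_edges_le_if_no_ear[OF sparse less.prems False] by linarith
  qed
qed

lemma card_outer_edges_le:
  assumes "girth_at_least (d + 2) E" "proper_subgraphs_sparse d V E" "cycle_in E vs"
  shows "d * card (outer_edges (cycle_edges vs)) + (d + 2)
    \<le> (d + 2) * card (outer_vertices (cycle_edges vs)) + length vs"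
proof -
  obtain pos' arcs' where drawing: "plane_drawing V E pos' arcs'"
    and outer: "plane_drawing.inner_edges E arcs' (cycle_edges vs) = outer_edges (cycle_edges vs)"
      "plane_drawing.inner_vertices V pos' arcs' (cycle_edges vs) = outer_vertices (cycle_edges vs)"
    using obtain_inverted_drawing[OF assms(3)] .
  show ?thesis
    using plane_drawing.card_inner_edges_le[OF drawing assms] by (simp only: outer)
qed

lemma card_edges_le_if_cycle:
  assumes girth: "girth_at_least (d + 2) E" and sparse: "proper_subgraphs_sparse d V E"
    and cycle: "cycle_in E vs"
  shows "d * card E + 2 * (d + 2) \<le> (d + 2) * card V"
proof -
  let ?C = "cycle_edges vs"
  have C: "?C \<subseteq> E" "\<Union>?C = set vs"
    using cycle by (auto simp: cycle_in_def intro!: Union_cycle_edges)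
  have "card E = card (?C \<union> inner_edges ?C \<union> outer_edges ?C)"
    using edges_trichotomy[OF C(1)] by simp
  also have "\<dots> \<le> card ?C + card (inner_edges ?C) + card (outer_edges ?C)"
    by (meson add_le_mono card_Un_le le_refl order_trans)
  finally have "card E \<le> length vs + card (inner_edges ?C) + card (outer_edges ?C)"
    using card_cycle_edges[of vs] by linarith
  then have edges: "d * card E \<le> d * (length vs + card (inner_edges ?C) + card (outer_edges ?C))"
    by (rule mult_le_mono2)
  have disjoint: "set vs \<inter> inner_vertices ?C = {}"
    "(set vs \<union> inner_vertices ?C) \<inter> outer_vertices ?C = {}"
    using inner_vertices_disjoint[OF C(1)] outer_vertices_disjoint[OF C(1)]
      inner_outer_vertices_disjoint[of ?C] unfolding C(2) by blast+
  have "length vs + card (inner_vertices ?C) + card (outer_vertices ?C)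
      = card (set vs \<union> inner_vertices ?C \<union> outer_vertices ?C)"
    using disjoint cycle finite_inner_vertices finite_outer_vertices
    by (simp add: card_Un_disjoint distinct_card cycle_in_def)
  also have "\<dots> \<le> card V"
    using finite_V cycle_vertices_subset[OF cycle]
    by (intro card_mono) (auto simp: inner_vertices_def outer_vertices_def)
  finally have "(d + 2) * (length vs + card (inner_vertices ?C) + card (outer_vertices ?C))
      \<le> (d + 2) * card V" by (rule mult_le_mono2)
  then show ?thesis
    using edges card_inner_edges_le[OF assms] card_outer_edges_le[OF assms]
    by (simp add: algebra_simps)
qed

end

lemma plane_drawing_sparse:
  assumes "plane_drawing V E pos arcs" "girth_at_least (d + 2) E" "V \<noteq> {}"
  shows "d * card E + (d + 2) \<le> (d + 2) * card V"
  using assms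
proof (induction "card V" arbitrary: V E rule: less_induct)
  case less
  interpret plane_drawing V E pos arcs by (rule less.prems(1))
  have sparse: "proper_subgraphs_sparse d V E"
    unfolding proper_subgraphs_sparse_def
  proof (intro allI impI)
    fix X assume X: "X \<subset> V" "X \<noteq> {}"
    show "d * card (induced E X) + (d + 2) \<le> (d + 2) * card X"
    proof (rule less.hyps)
      show "card X < card V" using X(1) finite_V by (rule psubset_card_mono[rotated])
      show "plane_drawing X (induced E X) pos arcs" using X by (intro plane_drawing_induced) auto
      show "girth_at_least (d + 2) (induced E X)"
        using less.prems(2) by (rule girth_at_least_subset) (auto simp: induced_def)
    qed (rule X)
  qed
  show ?case
  proof (cases "\<exists>vs. cycle_in E vs")
    case True
    then obtain vs where "cycle_in E vs" by blast
    then show ?thesis using card_edges_le_if_cycle[OF less.prems(2) sparse] by fastforce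
  next
    case False
    then have "card E + 1 \<le> card V" using card_edges_acyclic[OF graph less.prems(3)] by simp
    then have "(d + 2) * (card E + 1) \<le> (d + 2) * card V" by (rule mult_le_mono2)
    then show ?thesis by (simp add: algebra_simps)
  qed
qed

theorem planar_girth_card_edges:
  assumes "planar V E" "simple_graph V E" "girth_at_least (d + 2) E" "d + 4 \<le> 2 * card V"
  shows "d * card E + 2 * (d + 2) \<le> (d + 2) * card V"
proof -
  obtain pos arcs where "plane_drawing V E pos arcs"
    using planar_imp_plane_drawing[OF assms(1,2)] .
  then interpret plane_drawing V E pos arcs .
  show ?thesis
  proof (cases "\<exists>vs. cycle_in E vs")
    case True
    have "proper_subgraphs_sparse d V E"
      unfolding proper_subgraphs_sparse_def
      using plane_drawing_sparse[OF plane_drawing_induced] girth_at_least_subset[OF assms(3)]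
      by (auto simp: induced_def)
    then show ?thesis using True card_edges_le_if_cycle[OF assms(3)] by blast
  next
    case False
    have "V \<noteq> {}" using assms(4) by auto
    then have "d * (card E + 1) \<le> d * card V"
      using card_edges_acyclic[OF graph _ False] by (intro mult_le_mono2) simp
    then show ?thesis using assms(4) by (simp add: algebra_simps)
  qed
qed

section \<open>Straight-line drawings of the layers\<close>

lemma planar_straight_line:
  fixes pos :: "'a \<Rightarrow> complex"
  assumes edge: "\<And>e. e \<in> E \<Longrightarrow> e \<subseteq> V \<and> card e = 2" and inj: "inj_on pos V"
    and off: "\<And>e. e \<in> E \<Longrightarrow> (convex hull (pos ` e) - pos ` e) \<inter> pos ` V = {}"
    and cross: "\<And>e e'. e \<in> E \<Longrightarrow> e' \<in> E \<Longrightarrow> e \<noteq> e' \<Longrightarrow>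
        (convex hull (pos ` e) - pos ` e) \<inter> (convex hull (pos ` e') - pos ` e') = {}"
  shows "planar V E"
proof -
  have "\<exists>u v. e = {u, v} \<and> u \<noteq> v" if "e \<in> E" for e
    using edge[OF that] by (auto simp: card_2_iff)
  then obtain s t where ends_of: "\<And>e. e \<in> E \<Longrightarrow> e = {s e, t e} \<and> s e \<noteq> t e" by metis
  define arcs where "arcs e = linepath (pos (s e)) (pos (t e))" for e
  have ends: "pos ` e = {pos (s e), pos (t e)}" if "e \<in> E" for e
    using arg_cong[OF conjunct1[OF ends_of[OF that]], of "image pos"] by simp
  have image: "path_image (arcs e) = convex hull (pos ` e)" if "e \<in> E" for e
    unfolding ends[OF that] arcs_def by (simp add: segment_convex_hull)
  have "pos (s e) \<noteq> pos (t e)" if "e \<in> E" for e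
    using ends_of[OF that] edge[OF that] inj_onD[OF inj, of "s e" "t e"] by blast
  then have "arc (arcs e)" "{pathstart (arcs e), pathfinish (arcs e)} = pos ` e" if "e \<in> E" for e
    using ends[OF that] that by (simp_all add: arcs_def)
  moreover have "path_image (arcs e) \<inter> pos ` V = pos ` e" if "e \<in> E" for e
    using off[OF that] edge[OF that] hull_subset[of "pos ` e" convex] image[OF that] by blast
  moreover have "path_image (arcs e) \<inter> path_image (arcs e') \<subseteq> pos ` (e \<inter> e')"
    if e: "e \<in> E" "e' \<in> E" "e \<noteq> e'" for e e'
  proof -
    have "pos ` (e \<inter> e') = pos ` e \<inter> pos ` e'"
      using edge[OF e(1)] edge[OF e(2)] by (intro inj_on_image_Int[OF inj]) auto
    moreover have "pos ` e \<subseteq> pos ` V" "pos ` e' \<subseteq> pos ` V" using edge e by auto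
    moreover have "A \<inter> B \<subseteq> a \<inter> b" if "(A - a) \<inter> C = {}" "(B - b) \<inter> C = {}"
      "(A - a) \<inter> (B - b) = {}" "a \<subseteq> C" "b \<subseteq> C" for A B C a b :: "complex set"
      using that by blast
    note this[OF off[OF e(1)] off[OF e(2)] cross[OF e]]
    ultimately show ?thesis unfolding image[OF e(1)] image[OF e(2)] by simp
  qed
  ultimately show ?thesis
    unfolding planar_def using inj
    by (intro exI[of _ pos] exI[of _ arcs] conjI ballI impI) simp_all
qed

text \<open>The drawing of a layer has fourfold rotational symmetry: the cube is drawn as two concentric
  squares joined by four spokes, and in each of the four trapezoids between the squares arbitrarily
  many vertices, placed on one diagonal, are joined to the two corners off that diagonal.
  A piece is an open edge or a vertex in the sector of arguments \<open>[0, \<pi>/2)\<close>, the \<open>k\<close>-th sector being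
  obtained by a rotation through \<open>k \<pi>/2\<close>; the predicate \<open>cell\<close> gives the equations of the piece.\<close>

datatype piece = Spoke | Inner | Outer | Low real | High real
  | Inner_Vertex | Outer_Vertex | Mid_Vertex real

fun cell :: "piece \<Rightarrow> real \<Rightarrow> real \<Rightarrow> bool" where
  "cell Spoke x y \<longleftrightarrow> y = 0 \<and> 1 < x \<and> x < 2"
| "cell Inner x y \<longleftrightarrow> 0 < y \<and> x + y = 1"
| "cell Outer x y \<longleftrightarrow> 0 < y \<and> x + y = 2"
| "cell (Low t) x y \<longleftrightarrow> 0 < y \<and> 1 < x + y \<and> x + 2 * y < 2 \<and> t * (x + 2 * y - 1) = x + y - 1"
| "cell (High t) x y \<longleftrightarrow> 0 < y \<and> x + y < 2 \<and> 2 < x + 2 * y \<and> t * (4 - 2 * y - x) = x"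
| "cell Inner_Vertex x y \<longleftrightarrow> x = 1 \<and> y = 0"
| "cell Outer_Vertex x y \<longleftrightarrow> x = 2 \<and> y = 0"
| "cell (Mid_Vertex t) x y \<longleftrightarrow> 0 < y \<and> x = 2 * t \<and> y = 1 - t"

fun edge_piece :: "piece \<Rightarrow> bool" where
  "edge_piece (Low t) \<longleftrightarrow> 0 < t \<and> t < 1"
| "edge_piece (High t) \<longleftrightarrow> 0 < t \<and> t < 1"
| "edge_piece p \<longleftrightarrow> p \<in> {Spoke, Inner, Outer}"

fun vertex_piece :: "piece \<Rightarrow> bool" where
  "vertex_piece (Mid_Vertex t) \<longleftrightarrow> 0 < t \<and> t < 1"
| "vertex_piece p \<longleftrightarrow> p \<in> {Inner_Vertex, Outer_Vertex}"

fun endpoints :: "piece \<Rightarrow> complex \<times> complex" where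
  "endpoints Spoke = (1, 2)"
| "endpoints Inner = (1, \<i>)"
| "endpoints Outer = (2, 2 * \<i>)"
| "endpoints (Low t) = (1, Complex (2 * t) (1 - t))"
| "endpoints (High t) = (2 * \<i>, Complex (2 * t) (1 - t))"
| "endpoints Inner_Vertex = (1, 1)"
| "endpoints Outer_Vertex = (2, 2)"
| "endpoints (Mid_Vertex t) = (Complex (2 * t) (1 - t), Complex (2 * t) (1 - t))"

fun end_vertices :: "nat \<Rightarrow> piece \<Rightarrow> (nat \<times> piece) set" where
  "end_vertices k Spoke = {(k, Inner_Vertex), (k, Outer_Vertex)}"
| "end_vertices k Inner = {(k, Inner_Vertex), (Suc k mod 4, Inner_Vertex)}"
| "end_vertices k Outer = {(k, Outer_Vertex), (Suc k mod 4, Outer_Vertex)}"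
| "end_vertices k (Low t) = {(k, Inner_Vertex), (k, Mid_Vertex t)}"
| "end_vertices k (High t) = {(Suc k mod 4, Outer_Vertex), (k, Mid_Vertex t)}"
| "end_vertices k p = {(k, p)}"

definition rot :: "nat \<Rightarrow> complex \<Rightarrow> complex" where
  "rot k z = \<i> ^ k * z"

definition in_cell :: "piece \<Rightarrow> complex \<Rightarrow> bool" where
  "in_cell p z \<longleftrightarrow> 0 < Re z \<and> 0 \<le> Im z \<and> cell p (Re z) (Im z)"

definition vertex_point :: "nat \<times> piece \<Rightarrow> complex" where
  "vertex_point c = rot (fst c) (fst (endpoints (snd c)))"

lemma in_cell_unique:
  assumes "in_cell p z" "in_cell q z"
  shows "p = q"
proof -
  obtain x y where z: "z = Complex x y" by (cases z)
  have low: "t = t'" if "t * (x + 2 * y - 1) = x + y - 1" "t' * (x + 2 * y - 1) = x + y - 1"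
    "1 < x + y" "0 < y" for t t'
  proof -
    have "x + 2 * y - 1 > 0" using that by linarith
    then show ?thesis using that(1,2) by (metis less_irrefl mult_right_cancel)
  qed
  have high: "t = t'" if "t * (4 - 2 * y - x) = x" "t' * (4 - 2 * y - x) = x" "0 < x" for t t'
    using that by (metis less_irrefl mult_right_cancel mult_zero_right)
  show ?thesis
    using assms unfolding z in_cell_def by (cases p; cases q) (auto intro: low high)
qed

lemma rot_eq_imp_eq:
  assumes "rot k z = rot k' z'" "k < 4" "k' < 4" "0 < Re z" "0 \<le> Im z" "0 < Re z'" "0 \<le> Im z'"
  shows "k = k' \<and> z = z'"
proof -
  have "k \<in> {0, 1, 2, 3}" "k' \<in> {0, 1, 2, 3}" using assms by auto
  then show ?thesis
    using assms by (auto simp: rot_def complex_eq_iff power3_eq_cube)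
qed

lemma rot_in_cell_unique:
  assumes "in_cell p z" "in_cell p' z'" "rot k z = rot k' z'" "k < 4" "k' < 4"
  shows "k = k' \<and> p = p'"
  using rot_eq_imp_eq[OF assms(3-5)] assms(1,2) in_cell_unique by (auto simp: in_cell_def)

lemma rot_Suc_mod: "rot (Suc k mod 4) z = rot k (\<i> * z)"
proof -
  have "\<i> ^ (4 * (Suc k div 4) + Suc k mod 4) = (\<i> ^ 4) ^ (Suc k div 4) * \<i> ^ (Suc k mod 4)"
    by (simp only: power_add power_mult)
  then have "\<i> ^ (Suc k mod 4) = \<i> ^ Suc k" by (simp add: power4_eq_xxxx)
  then show ?thesis by (simp add: rot_def)
qed

lemma vertex_point_end_vertices:
  "vertex_point ` end_vertices k p = {rot k (fst (endpoints p)), rot k (snd (endpoints p))}"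
  by (cases p) (simp_all add: vertex_point_def rot_Suc_mod insert_commute mult.commute)

lemma vertex_piece_in_cell: "vertex_piece p \<Longrightarrow> in_cell p (fst (endpoints p))"
  by (cases p) (auto simp: in_cell_def)

lemma vertex_piece_not_edge_piece: "vertex_piece p \<Longrightarrow> \<not> edge_piece p"
  by (cases p) auto

lemma edge_piece_in_cell:
  assumes "edge_piece p" and s: "0 < s" "s < 1"
  shows "in_cell p ((1 - s) *\<^sub>R fst (endpoints p) + s *\<^sub>R snd (endpoints p))"
proof (cases p)
  case (Low t)
  define w where "w = s * t"
  have w: "0 < w" "w < s" using assms by (simp_all add: Low w_def)
  have "t * (1 - s + 2 * w + 2 * (s - w) - 1) = w" by (simp add: w_def)
  then have "in_cell p (Complex (1 - s + 2 * w) (s - w))"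
    using w s by (simp add: Low in_cell_def)
  moreover have "(1 - s) *\<^sub>R fst (endpoints p) + s *\<^sub>R snd (endpoints p)
      = Complex (1 - s + 2 * w) (s - w)"
    by (simp add: Low w_def complex_eq_iff algebra_simps)
  ultimately show ?thesis by simp
next
  case (High t)
  define w where "w = s * t"
  have w: "0 < w" "w < s" using assms by (simp_all add: High w_def)
  have "t * (4 - 2 * (2 - s - w) - 2 * w) = 2 * w" by (simp add: w_def)
  then have "in_cell p (Complex (2 * w) (2 - s - w))"
    using w s by (simp add: High in_cell_def)
  moreover have "(1 - s) *\<^sub>R fst (endpoints p) + s *\<^sub>R snd (endpoints p)
      = Complex (2 * w) (2 - s - w)"
    by (simp add: High w_def complex_eq_iff algebra_simps)
  ultimately show ?thesis by simp
qed (use assms in \<open>auto simp: in_cell_def\<close>)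

lemma open_edge_in_cell:
  assumes "edge_piece p"
    and z: "z \<in> convex hull (vertex_point ` end_vertices k p) - vertex_point ` end_vertices k p"
  obtains w where "z = rot k w" "in_cell p w"
proof -
  have "z \<in> open_segment (rot k (fst (endpoints p))) (rot k (snd (endpoints p)))"
    using z unfolding vertex_point_end_vertices open_segment_def by (simp add: segment_convex_hull)
  then obtain s where s: "0 < s" "s < 1"
    "z = (1 - s) *\<^sub>R rot k (fst (endpoints p)) + s *\<^sub>R rot k (snd (endpoints p))"
    by (auto simp: in_segment)
  then have "z = rot k ((1 - s) *\<^sub>R fst (endpoints p) + s *\<^sub>R snd (endpoints p))"
    by (simp add: rot_def distrib_left)
  then show thesis using that edge_piece_in_cell[OF assms(1) s(1,2)] by blast
qed

definition vertex_code :: "nat \<times> piece \<Rightarrow> bool" where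
  "vertex_code c \<longleftrightarrow> fst c < 4 \<and> vertex_piece (snd c)"

definition edge_code :: "(nat \<times> piece) set \<Rightarrow> bool" where
  "edge_code A \<longleftrightarrow> (\<exists>k p. k < 4 \<and> edge_piece p \<and> A = end_vertices k p)"

lemma inj_on_vertex_point: "inj_on vertex_point {c. vertex_code c}"
proof (rule inj_onI)
  fix c c'
  assume "c \<in> {c. vertex_code c}" "c' \<in> {c. vertex_code c}" "vertex_point c = vertex_point c'"
  then show "c = c'"
    using rot_in_cell_unique[OF vertex_piece_in_cell vertex_piece_in_cell,
        of "snd c" "snd c'" "fst c" "fst c'"]
    by (simp add: vertex_code_def vertex_point_def prod_eq_iff)
qed

lemma open_edge_avoids_vertices:
  assumes "edge_code A" "vertex_code c"
  shows "vertex_point c \<notin> convex hull (vertex_point ` A) - vertex_point ` A"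
proof
  obtain k p where A: "k < 4" "edge_piece p" "A = end_vertices k p"
    using assms(1) by (auto simp: edge_code_def)
  assume "vertex_point c \<in> convex hull (vertex_point ` A) - vertex_point ` A"
  then obtain w where "vertex_point c = rot k w" "in_cell p w"
    unfolding A(3) by (rule open_edge_in_cell[OF A(2)])
  then have "p = snd c"
    using rot_in_cell_unique[OF _ vertex_piece_in_cell, of p w "snd c" k "fst c"] A(1) assms(2)
    by (simp add: vertex_code_def vertex_point_def)
  then show False
    using A(2) assms(2) vertex_piece_not_edge_piece by (auto simp: vertex_code_def)
qed

lemma open_edges_disjoint:
  assumes "edge_code A" "edge_code B" "A \<noteq> B"
  shows "(convex hull (vertex_point ` A) - vertex_point ` A)
    \<inter> (convex hull (vertex_point ` B) - vertex_point ` B) = {}"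
proof (rule ccontr)
  obtain k p where A: "k < 4" "edge_piece p" "A = end_vertices k p"
    using assms(1) by (auto simp: edge_code_def)
  obtain k' p' where B: "k' < 4" "edge_piece p'" "B = end_vertices k' p'"
    using assms(2) by (auto simp: edge_code_def)
  assume "\<not> ?thesis"
  then obtain z where z: "z \<in> convex hull (vertex_point ` A) - vertex_point ` A"
    "z \<in> convex hull (vertex_point ` B) - vertex_point ` B" by blast
  obtain w where w: "z = rot k w" "in_cell p w"
    using z(1) unfolding A(3) by (rule open_edge_in_cell[OF A(2)])
  obtain w' where w': "z = rot k' w'" "in_cell p' w'"
    using z(2) unfolding B(3) by (rule open_edge_in_cell[OF B(2)])
  have "k = k' \<and> p = p'"
    using rot_in_cell_unique[OF w(2) w'(2) _ A(1) B(1)] w(1) w'(1) by simp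
  then show False using A(3) B(3) assms(3) by simp
qed

lemma planar_coded:
  assumes edge: "\<And>e. e \<in> E \<Longrightarrow> e \<subseteq> V \<and> card e = 2" and inj: "inj_on code V"
    and vertex_code: "\<And>v. v \<in> V \<Longrightarrow> vertex_code (code v)"
    and edge_code: "\<And>e. e \<in> E \<Longrightarrow> edge_code (code ` e)"
  shows "planar V E"
proof (rule planar_straight_line[where pos = "vertex_point \<circ> code"])
  show "e \<subseteq> V \<and> card e = 2" if "e \<in> E" for e using that by (rule edge)
  show "inj_on (vertex_point \<circ> code) V"
    using inj vertex_code inj_on_subset[OF inj_on_vertex_point, of "code ` V"]
    by (auto intro!: comp_inj_on)
  show "(convex hull ((vertex_point \<circ> code) ` e) - (vertex_point \<circ> code) ` e)
      \<inter> (vertex_point \<circ> code) ` V = {}" if "e \<in> E" for e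
    using open_edge_avoids_vertices[OF edge_code[OF that]] vertex_code
    unfolding image_comp[symmetric] by blast
  show "(convex hull ((vertex_point \<circ> code) ` e) - (vertex_point \<circ> code) ` e)
      \<inter> (convex hull ((vertex_point \<circ> code) ` e') - (vertex_point \<circ> code) ` e') = {}"
    if e: "e \<in> E" "e' \<in> E" "e \<noteq> e'" for e e'
  proof -
    have "code ` e \<noteq> code ` e'"
      using inj_on_image_eq_iff[OF inj, of e e'] edge e by blast
    then show ?thesis
      using open_edges_disjoint[OF edge_code[OF e(1)] edge_code[OF e(2)]]
      unfolding image_comp[symmetric] by blast
  qed
qed

section \<open>The layers of the crown graph\<close>

definition crown_edges :: "nat \<Rightarrow> (nat \<times> nat) set set" where
  "crown_edges n = {{(u, 0), (v, 1)} | u v. u < n \<and> v < n \<and> u \<noteq> v}"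

lemma kron_complete_K2:
  "kron_edges (complete_edges {0..<n}) (complete_edges {0..<2::nat}) = crown_edges n"
proof
  show "kron_edges (complete_edges {0..<n}) (complete_edges {0..<2::nat}) \<subseteq> crown_edges n"
  proof
    fix e assume "e \<in> kron_edges (complete_edges {0..<n}) (complete_edges {0..<2::nat})"
    then obtain g h g' h' where e: "e = {(g, h), (g', h')}"
      and g: "{g, g'} \<in> complete_edges {0..<n}" and h: "{h, h'} \<in> complete_edges {0..<2::nat}"
      by (auto simp: kron_edges_def)
    have "g < n" "g' < n" "g \<noteq> g'" using g by (auto simp: complete_edges_def doubleton_eq_iff)
    moreover have "h = 0 \<and> h' = 1 \<or> h = 1 \<and> h' = 0"
      using h by (auto simp: complete_edges_def doubleton_eq_iff)
    ultimately show "e \<in> crown_edges n" unfolding e by (auto simp: crown_edges_def insert_commute)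
  qed
  show "crown_edges n \<subseteq> kron_edges (complete_edges {0..<n}) (complete_edges {0..<2::nat})"
    unfolding crown_edges_def
  proof clarify
    fix u v :: nat assume "u < n" "v < n" "u \<noteq> v"
    then have "{u, v} \<in> complete_edges {0..<n}" by (auto simp: complete_edges_def)
    moreover have "{0, 1} \<in> complete_edges {0..<2::nat}"
      unfolding complete_edges_def by (intro CollectI exI[of _ 0] exI[of _ 1]) simp
    ultimately show
      "{(u, 0), (v, 1)} \<in> kron_edges (complete_edges {0..<n}) (complete_edges {0..<2::nat})"
      by (auto simp: kron_edges_def)
  qed
qed

lemma card_crown_edges: "card (crown_edges n) = n * (n - 1)"
proof -
  let ?S = "{0..<n} \<times> {0..<n} - (\<lambda>u. (u, u)) ` {0..<n}"
  let ?f = "\<lambda>(u, v). {(u, 0::nat), (v, 1)}"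
  have "crown_edges n = ?f ` ?S"
    by (auto simp: crown_edges_def image_iff) blast
  moreover have "inj_on ?f ?S" by (auto simp: inj_on_def doubleton_eq_iff)
  ultimately have "card (crown_edges n) = card ?S" by (simp add: card_image)
  also have "\<dots> = card ({0..<n} \<times> {0..<n}) - card ((\<lambda>u. (u, u)) ` {0..<n})"
    by (intro card_Diff_subset) auto
  also have "\<dots> = n * (n - 1)"
    by (simp add: card_image inj_on_def diff_mult_distrib2)
  finally show ?thesis .
qed

lemma simple_graph_crown: "simple_graph ({0..<n} \<times> {0..<2}) (crown_edges n)"
  by (auto simp: simple_graph_def crown_edges_def)

fun cube_code :: "nat \<times> nat \<Rightarrow> nat \<times> piece" where
  "cube_code (a, s) =
    (if s = 0 then [(2, Outer_Vertex), (1, Inner_Vertex), (3, Inner_Vertex), (0, Outer_Vertex)] ! a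
     else [(0, Inner_Vertex), (3, Outer_Vertex), (1, Outer_Vertex), (2, Inner_Vertex)] ! a)"

fun face :: "nat \<times> nat \<Rightarrow> nat" where
  "face (x, s) = (if s = 0 then if x mod 4 < 2 then 0 else 2 else if odd x then 1 else 3)"

fun layer_code :: "nat \<Rightarrow> nat \<times> nat \<Rightarrow> nat \<times> piece" where
  "layer_code r (x, s) =
    (if x div 4 = r then cube_code (x mod 4, s) else (face (x, s), Mid_Vertex (1 / (real x + 2))))"

text \<open>An edge goes to the block of one of its ends, chosen so that in layer \<open>r\<close> each vertex outside
  block \<open>r\<close> is joined to two opposite corners of a face of the cube.\<close>

definition layer :: "nat \<Rightarrow> nat \<Rightarrow> nat" where
  "layer u v = (if even v \<longleftrightarrow> u mod 4 < 2 then v div 4 else u div 4)"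

definition layer_edges :: "nat \<Rightarrow> nat \<Rightarrow> (nat \<times> nat) set set" where
  "layer_edges n r = {{(u, 0), (v, 1)} | u v. u < n \<and> v < n \<and> u \<noteq> v \<and> layer u v = r}"

definition face_corner :: "nat \<Rightarrow> nat \<times> piece \<Rightarrow> bool" where
  "face_corner k c \<longleftrightarrow> c = (k, Inner_Vertex) \<or> c = (Suc k mod 4, Outer_Vertex)"

lemma mod_4_cases: "(x::nat) mod 4 = 0 \<or> x mod 4 = 1 \<or> x mod 4 = 2 \<or> x mod 4 = 3"
  by auto

lemma odd_iff_odd_mod_4: "odd (x::nat) \<longleftrightarrow> odd (x mod 4)"
  by presburger

lemma edge_code_cube:
  assumes "u mod 4 \<noteq> v mod 4"
  shows "edge_code {cube_code (u mod 4, 0), cube_code (v mod 4, 1)}"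
proof -
  have "\<exists>k\<in>{0, 1, 2, 3}. \<exists>p\<in>{Spoke, Inner, Outer}.
      {cube_code (u mod 4, 0), cube_code (v mod 4, 1)} = end_vertices k p"
    using assms mod_4_cases[of u] mod_4_cases[of v]
    by (elim disjE) (simp_all add: doubleton_eq_iff)
  then obtain k p where "k \<in> {0, 1, 2, 3}" "p \<in> {Spoke, Inner, Outer}"
    and ends: "{cube_code (u mod 4, 0), cube_code (v mod 4, 1)} = end_vertices k p" by (elim bexE)
  then have "k < 4" "edge_piece p" by auto
  then show ?thesis unfolding edge_code_def using ends by (intro exI conjI)
qed

lemma edge_code_face:
  assumes "face_corner k c" "k < 4" "0 < t" "t < 1"
  shows "edge_code {c, (k, Mid_Vertex t)}"
proof -
  have "{c, (k, Mid_Vertex t)} = end_vertices k (Low t) \<or>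
      {c, (k, Mid_Vertex t)} = end_vertices k (High t)"
    using assms(1) by (auto simp: face_corner_def)
  moreover have "edge_piece (Low t)" "edge_piece (High t)" using assms by simp_all
  ultimately show ?thesis using assms(2) unfolding edge_code_def by blast
qed

lemma face_corner_cube:
  shows "(even v \<longleftrightarrow> u mod 4 < 2) \<Longrightarrow> face_corner (face (u, 0)) (cube_code (v mod 4, 1))"
    and "\<not> (even v \<longleftrightarrow> u mod 4 < 2) \<Longrightarrow> face_corner (face (v, 1)) (cube_code (u mod 4, 0))"
  using mod_4_cases[of u] mod_4_cases[of v] odd_iff_odd_mod_4[of v]
  by (elim disjE; simp add: face_corner_def)+

lemma face_less_4: "face v < 4"
  by (cases v) simp

lemma vertex_code_layer_code: "vertex_code (layer_code r v)"
proof -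
  obtain x s where "v = (x, s)" by (cases v)
  then show ?thesis using mod_4_cases[of x] by (auto simp: vertex_code_def)
qed

lemma inj_on_layer_code: "inj_on (layer_code r) (UNIV \<times> {0..<2})"
proof (rule inj_onI, clarify)
  fix x s y s' :: nat
  assume "s \<in> {0..<2}" "s' \<in> {0..<2}" and eq: "layer_code r (x, s) = layer_code r (y, s')"
  then have s: "s = 0 \<or> s = 1" "s' = 0 \<or> s' = 1" by auto
  show "x = y \<and> s = s'"
  proof (cases "x div 4 = r \<and> y div 4 = r")
    case True
    then have "x mod 4 = y mod 4 \<and> s = s'"
      using eq s mod_4_cases[of x] mod_4_cases[of y] by auto
    then show ?thesis using True by (metis div_mult_mod_eq)
  next
    case False
    then have "x div 4 \<noteq> r" "y div 4 \<noteq> r"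
      using eq s mod_4_cases[of x] mod_4_cases[of y] by (auto split: if_splits)
    then show ?thesis using eq s by (auto split: if_splits)
  qed
qed

lemma edge_code_layer_code:
  assumes "u \<noteq> v"
  shows "edge_code {layer_code (layer u v) (u, 0), layer_code (layer u v) (v, 1)}"
proof -
  have t: "0 < 1 / (real x + 2)" "1 / (real x + 2) < 1" for x by simp_all
  show ?thesis
  proof (cases "u div 4 = v div 4")
    case True
    then have "layer u v = u div 4" by (simp add: layer_def)
    moreover have "u mod 4 \<noteq> v mod 4" using assms True by (metis div_mult_mod_eq)
    ultimately show ?thesis
      using edge_code_cube True by (simp del: cube_code.simps)
  next
    case False
    show ?thesis
    proof (cases "even v \<longleftrightarrow> u mod 4 < 2")
      case True
      then have "layer u v = v div 4" by (simp add: layer_def)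
      then show ?thesis
        using edge_code_face[OF face_corner_cube(1)[OF True] face_less_4 t[of u]] False
        by (simp del: cube_code.simps face.simps add: insert_commute)
    next
      case parity: False
      then have "layer u v = u div 4" by (simp add: layer_def)
      then show ?thesis
        using edge_code_face[OF face_corner_cube(2)[OF parity] face_less_4 t[of v]] False
        by (simp del: cube_code.simps face.simps)
    qed
  qed
qed

lemma planar_layer: "planar ({0..<n} \<times> {0..<2}) (layer_edges n r)"
proof (rule planar_coded[where code = "layer_code r"])
  show "e \<subseteq> {0..<n} \<times> {0..<2} \<and> card e = 2" if "e \<in> layer_edges n r" for e
    using that by (auto simp: layer_edges_def)
  show "inj_on (layer_code r) ({0..<n} \<times> {0..<2})"
    using inj_on_layer_code by (rule inj_on_subset) auto
  show "vertex_code (layer_code r v)" for v by (rule vertex_code_layer_code)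
  show "edge_code (layer_code r ` e)" if "e \<in> layer_edges n r" for e
    using that edge_code_layer_code by (auto simp: layer_edges_def simp del: layer_code.simps)
qed

section \<open>The thickness\<close>

definition planar_decomposition :: "'a set \<Rightarrow> 'a set set \<Rightarrow> nat \<Rightarrow> (nat \<Rightarrow> 'a set set) \<Rightarrow> bool" where
  "planar_decomposition V E k F \<longleftrightarrow>
     (\<forall>i<k. F i \<subseteq> E \<and> planar V (F i)) \<and> (\<Union>i<k. F i) = E"

definition bipartite :: "('a \<Rightarrow> bool) \<Rightarrow> 'a set set \<Rightarrow> bool" where
  "bipartite c E \<longleftrightarrow> (\<forall>e\<in>E. \<exists>x y. e = {x, y} \<and> c x \<noteq> c y)"

lemma thickness_eqI:
  assumes "planar_decomposition V E k F" "\<And>j G. planar_decomposition V E j G \<Longrightarrow> k \<le> j"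
  shows "thickness V E = k"
  unfolding thickness_def
  by (rule Least_equality) (use assms in \<open>auto simp: planar_decomposition_def\<close>)

lemma bipartite_girth_at_least_4:
  assumes "bipartite c E"
  shows "girth_at_least 4 E"
  unfolding girth_at_least_def
proof (intro allI impI, rule ccontr)
  fix vs assume cycle: "cycle_in E vs" and "\<not> 4 \<le> length vs"
  then have "length vs = 3" by (simp add: cycle_in_def)
  then obtain x y z where "vs = [x, y, z]" by (auto simp: length_Suc_conv numeral_3_eq_3)
  moreover have "c u \<noteq> c v" if "{u, v} \<in> E" for u v
    using assms that by (fastforce simp: bipartite_def doubleton_eq_iff)
  ultimately have "c x \<noteq> c y" "c y \<noteq> c z" "c z \<noteq> c x"
    using cycle by (auto simp: cycle_in_def cycle_edges_def)
  then show False by blast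
qed

lemma planar_bipartite_card_edges:
  assumes "planar V E" "simple_graph V E" "bipartite c E" "3 \<le> card V"
  shows "card E \<le> 2 * card V - 4"
  using planar_girth_card_edges[of V E 2] bipartite_girth_at_least_4[OF assms(3)] assms by simp

lemma bipartite_card_edges_le_planar_decomposition:
  assumes "planar_decomposition V E k F" "simple_graph V E" "bipartite c E" "3 \<le> card V"
  shows "card E \<le> k * (2 * card V - 4)"
proof -
  have "card (F i) \<le> 2 * card V - 4" if "i < k" for i
  proof (rule planar_bipartite_card_edges[OF _ _ _ assms(4)])
    show "planar V (F i)" using assms(1) that by (simp add: planar_decomposition_def)
    have "F i \<subseteq> E" using assms(1) that by (simp add: planar_decomposition_def)
    then show "simple_graph V (F i)" "bipartite c (F i)"
      using assms(2,3) by (auto simp: simple_graph_def bipartite_def)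
  qed
  then have "(\<Sum>i<k. card (F i)) \<le> k * (2 * card V - 4)"
    using sum_mono[of "{..<k}" "\<lambda>i. card (F i)" "\<lambda>_. 2 * card V - 4"] by simp
  moreover have "card E \<le> (\<Sum>i<k. card (F i))"
    using assms(1) card_UN_le[of "{..<k}" F] by (simp add: planar_decomposition_def)
  ultimately show ?thesis by simp
qed

lemma planar_decomposition_crown:
  assumes "n \<le> 4 * k"
  shows "planar_decomposition ({0..<n} \<times> {0..<2}) (crown_edges n) k (layer_edges n)"
proof -
  have "layer u v < k" if "u < n" "v < n" for u v
    using that assms by (auto simp: layer_def)
  then have "crown_edges n \<subseteq> (\<Union>r<k. layer_edges n r)"
    unfolding crown_edges_def layer_edges_def by blast
  moreover have "layer_edges n r \<subseteq> crown_edges n" for r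
    unfolding crown_edges_def layer_edges_def by blast
  ultimately show ?thesis using planar_layer by (auto simp: planar_decomposition_def)
qed

lemma crown_planar_decomposition_bound:
  assumes "n \<ge> 2" "planar_decomposition ({0..<n} \<times> {0..<2}) (crown_edges n) k F"
  shows "n \<le> 4 * k"
proof -
  have "bipartite (\<lambda>v. snd v = 0) (crown_edges n)"
    by (force simp: bipartite_def crown_edges_def)
  then have "n * (n - 1) \<le> k * (2 * (n * 2) - 4)"
    using bipartite_card_edges_le_planar_decomposition[OF assms(2) simple_graph_crown] assms(1)
    by (simp add: card_crown_edges card_cartesian_product)
  also have "\<dots> = 4 * k * (n - 1)" by (simp add: algebra_simps)
  finally show ?thesis using assms(1) by simp
qed

theorem theorem3p3:
  fixes n :: nat
  assumes "n \<ge> 2"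
  shows "thickness ({0..<n} \<times> {0..<2::nat})
           (kron_edges (complete_edges {0..<n}) (complete_edges {0..<2::nat}))
         = nat \<lceil>real n / 4\<rceil>"
  unfolding kron_complete_K2
proof (rule thickness_eqI)
  have ceiling_le: "nat \<lceil>real n / 4\<rceil> \<le> k \<longleftrightarrow> n \<le> 4 * k" for k
    by (simp add: nat_le_iff ceiling_le_iff) linarith
  then show "planar_decomposition ({0..<n} \<times> {0..<2}) (crown_edges n)
      (nat \<lceil>real n / 4\<rceil>) (layer_edges n)"
    by (intro planar_decomposition_crown) blast
  show "nat \<lceil>real n / 4\<rceil> \<le> k"
    if "planar_decomposition ({0..<n} \<times> {0..<2}) (crown_edges n) k F" for k F
    using crown_planar_decomposition_bound[OF assms that] ceiling_le by blast
qed

end
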